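(* Let $\mathbf{W}=\{\mathbf{W}(t):t\ge 0\}$ be standard planar Brownian motion started at the origin, let $\mathrm{H}=\operatorname{conv}\{\mathbf{W}(s):s\in[0,1]\}$, and let $\mathsf{r}$ be the inradius of $\mathrm{H}$. Then $$\mathbb{E}[\mathsf{r}]\ge \frac{\sqrt{\pi}}{8+4\sqrt{2}}\approx 0.1297.$$
   Context: Standard planar Brownian motion is $\mathbf{W}(t)=(W_1(t),W_2(t))$ with $W_1,W_2$ independent one-dimensional standard Brownian motions started at $0$. $\operatorname{conv}A$ is the convex hull of $A\subset\mathbb{R}^2$. The inradius of a planar convex set is the radius of the largest disk contained in it. The symbol $\approx$ only indicates a numerical approximation of the exact expression. *)

theory Defs
  imports "HOL-Probability.Probability"
begin

text \<open>
  Processes are indexed by \<^typ>\<open>real\<close>; only their values at times \<open>t \<ge> 0\<close> matter.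
  Every path is continuous on \<open>[0, \<infinity>)\<close>, not only almost every one, so that path functionals
  such as the inradius below are measurable even when the measure \<open>M\<close> is not complete.
\<close>

locale standard_brownian_motion = prob_space M for M :: "'a measure" +
  fixes B :: "real \<Rightarrow> 'a \<Rightarrow> real"
  assumes measurable_at: "0 \<le> t \<Longrightarrow> random_variable borel (B t)"
    and starts_at_0: "AE \<omega> in M. B 0 \<omega> = 0"
    and continuous_paths: "\<omega> \<in> space M \<Longrightarrow> continuous_on {0..} (\<lambda>t. B t \<omega>)"
    and gaussian_increments:
      "0 \<le> s \<Longrightarrow> s < t \<Longrightarrow>
        distributed M lborel (\<lambda>\<omega>. B t \<omega> - B s \<omega>) (\<lambda>x. ennreal (normal_density 0 (sqrt (t - s)) x))"
    and independent_increments: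
      "0 \<le> u 0 \<Longrightarrow> (\<And>i. i < n \<Longrightarrow> u i < u (Suc i)) \<Longrightarrow>
        indep_vars (\<lambda>_. borel) (\<lambda>i \<omega>. B (u (Suc i)) \<omega> - B (u i) \<omega>) {..<n::nat}"

text \<open>
  The coordinates are independent as processes, that is, as random elements of the product
  space of all functions \<open>[0, \<infinity>) \<rightarrow> \<real>\<close> with its product \<open>\<sigma>\<close>-algebra.
\<close>

locale planar_brownian_motion = prob_space M for M :: "'a measure" +
  fixes W :: "real \<Rightarrow> 'a \<Rightarrow> real ^ 2"
  assumes coordinate_brownian: "standard_brownian_motion M (\<lambda>t \<omega>. W t \<omega> $ i)"
    and independent_coordinates:
      "indep_var
        (\<Pi>\<^sub>M t\<in>{0..}. borel) (\<lambda>\<omega>. \<lambda>t\<in>{0..}. W t \<omega> $ 1)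
        (\<Pi>\<^sub>M t\<in>{0..}. borel) (\<lambda>\<omega>. \<lambda>t\<in>{0..}. W t \<omega> $ 2)"

text \<open>
  Degenerate disks (radius \<open>0\<close>) are allowed, so that a nonempty set with empty interior has
  inradius \<open>0\<close>. For nonempty compact sets the supremum is attained.
\<close>

definition inradius :: "(real ^ 2) set \<Rightarrow> real" where
  "inradius K = Sup {\<rho>. 0 \<le> \<rho> \<and> (\<exists>c. cball c \<rho> \<subseteq> K)}"

end

theory Submission
  imports Defs "HOL-Real_Asymp.Real_Asymp"
begin

text \<open>
  The hull contains the triangle with vertices \<open>W 0\<close>, \<open>W (1/2)\<close>, \<open>W 1\<close>. With
  \<open>X = W (1/2) - W 0\<close> and \<open>Y = W 1 - W (1/2)\<close>, its inradius is
  \<open>\<bar>X \<times> Y\<bar> / (\<bar>X\<bar> + \<bar>Y\<bar> + \<bar>X + Y\<bar>)\<close>. The law of \<open>(X, Y)\<close> is Gaussian and invariant under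
  \<open>Y \<mapsto> - Y\<close>; averaging over this reflection and using convexity of \<open>t \<mapsto> 1 / t\<close> bounds the
  expectation below by that of \<open>\<bar>X \<times> Y\<bar> / ((1 + \<surd>2) h)\<close> with \<open>h\<^sup>2 = \<bar>X\<bar>\<^sup>2 + \<bar>Y\<bar>\<^sup>2\<close>, which equals
  \<open>3 \<surd>\<pi> / (16 (1 + \<surd>2))\<close> and exceeds the claimed constant. Since the Bochner integral of a
  non-integrable function is \<open>0\<close>, the inradius must also be shown to be measurable and integrable.
\<close>

section \<open>Disks in triangles and the inradius\<close>

text \<open>Splitting at time 1/2 makes all four coordinates of X and Y independent with the same
  variance 1/2. The perimeter resists explicit integration mainly through its third side |X + Y|,
  which couples the two increments. Reflection keeps |X|, |Y| and the absolute cross product but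
  turns this side into |X - Y|, and the two third sides average to at most h; |X| + |Y| is at most
  sqrt 2 times h, so only the rotation-invariant h is left in the denominator. The remaining
  division by h is traded for an auxiliary Gaussian integral over s: exp (- s^2 h^2) factors over
  the coordinates and merely shrinks their variances, leaving the expectation of |X x Y| under
  centred normal laws.

  For integrability, a disk in the hull is no wider than the hull along the first axis, so a finite
  expected bound for the displacement of one coordinate is enough. Dyadic chaining supplies it from
  Gaussian increments and continuity alone, without a maximal inequality. Measurability comes from
  testing membership in the hull with countably many half-planes and rational times.\<close>

lemma triangle_contains_disk:
  fixes A B C :: "real^2"
  defines "d \<equiv> \<bar>(B - A) $ 1 * (C - B) $ 2 - (B - A) $ 2 * (C - B) $ 1\<bar>"
  defines "p \<equiv> norm (B - A) + norm (C - B) + norm (C - A)"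
  shows "\<exists>c. cball c (d / p) \<subseteq> convex hull {A, B, C}"
proof (cases "d = 0")
  \<comment> \<open>This case includes \<open>p = 0\<close>, since \<open>d / p\<close> is then 0
    too; the disk is a single vertex.\<close>
  case True
  then show ?thesis
    by (intro exI[of _ A]) (auto simp: hull_inc)
next
  case False
  define D where "D = (B - A) $ 1 * (C - B) $ 2 - (B - A) $ 2 * (C - B) $ 1"
  have D: "D \<noteq> 0" "\<bar>D\<bar> = d" using False by (auto simp: D_def d_def)
  then have d: "d > 0" by auto
  have "B \<noteq> A" using D by (auto simp: D_def)
  then have p: "p > 0" unfolding p_def by (intro add_pos_nonneg) auto
  define a b c where "a = norm (C - B)" and "b = norm (C - A)" and "c = norm (B - A)"
  have pabc: "p = a + b + c" by (simp add: p_def a_def b_def c_def)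
  \<comment> \<open>\<open>d\<close> is twice the area and \<open>p\<close> the perimeter, so
    \<open>d / p\<close> is the inradius. \<open>I\<close> is the incenter: its barycentric weights
    are the lengths of the opposite sides over \<open>p\<close>.\<close>
  define I where "I = (a/p) *\<^sub>R A + (b/p) *\<^sub>R B + (c/p) *\<^sub>R C"
  have cross: "\<bar>v$1 * w$2 - v$2 * w$1\<bar> / d \<le> norm w / p" if "norm v \<le> d / p" for v w :: "real^2"
  proof -
    \<comment> \<open>Lagrange's identity, which bounds the cross product by the product of the
      norms.\<close>
    have "(norm v * norm w)\<^sup>2 - (v$1 * w$2 - v$2 * w$1)\<^sup>2 = (v \<bullet> w)\<^sup>2"
      unfolding power_mult_distrib power2_norm_eq_inner
      unfolding inner_vec_def sum_2 inner_real_def by algebra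
    then have "(v$1 * w$2 - v$2 * w$1)\<^sup>2 \<le> (norm v * norm w)\<^sup>2"
      by (metis diff_ge_0_iff_ge zero_le_power2)
    then have "\<bar>v$1 * w$2 - v$2 * w$1\<bar> \<le> norm v * norm w"
      by (rule abs_le_square_iff[THEN iffD2, THEN order_trans]) simp
    also have "\<dots> \<le> d / p * norm w" using that by (intro mult_right_mono) auto
    finally show ?thesis using d p by (simp add: field_simps)
  qed
  have "cball I (d / p) \<subseteq> convex hull {A, B, C}"
  proof
    fix q assume "q \<in> cball I (d / p)"
    define v where "v = q - I"
    have v: "norm v \<le> d / p" using \<open>q \<in> _\<close> by (simp add: v_def dist_norm norm_minus_commute)
    \<comment> \<open>Moving from \<open>I\<close> to \<open>q\<close> changes each barycentric
      weight by \<open>k\<close> of the opposite side, up to sign. The bound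
      \<open>norm w / p\<close> for this change is exactly the weight of that vertex at
      \<open>I\<close>, so no weight becomes negative.\<close>
    define k where "k w = (v$2 * w$1 - v$1 * w$2) / D" for w :: "real^2"
    have k: "\<bar>k w\<bar> \<le> norm w / p" for w
      using cross[OF v, of w] D by (simp add: k_def abs_minus_commute)
    have "a / p + k (C - B) \<ge> 0" "b / p - k (C - A) \<ge> 0" "c / p + k (B - A) \<ge> 0"
      using k[of "C - B"] k[of "C - A"] k[of "B - A"] by (auto simp: a_def b_def c_def)
    moreover have "(a / p + k (C - B)) + (b / p - k (C - A)) + (c / p + k (B - A)) = 1"
    proof -
      have "k (C - B) - k (C - A) + k (B - A) = 0"
        by (simp add: k_def add_divide_distrib[symmetric] diff_divide_distrib[symmetric] algebra_simps)
      moreover have "a/p + b/p + c/p = 1" using p by (simp add: add_divide_distrib[symmetric] flip: pabc)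
      ultimately show ?thesis by linarith
    qed
    moreover have "q = (a / p + k (C - B)) *\<^sub>R A + (b / p - k (C - A)) *\<^sub>R B + (c / p + k (B - A)) *\<^sub>R C"
    proof -
      have "k (C - B) *\<^sub>R A - k (C - A) *\<^sub>R B + k (B - A) *\<^sub>R C = v"
      proof (subst vec_eq_iff, rule allI)
        fix i :: 2
        have "i = 1 \<or> i = 2" using exhaust_2 by auto
        moreover have "D * (k (C - B) * A$i - k (C - A) * B$i + k (B - A) * C$i) = D * v$i"
          if "i = 1 \<or> i = 2"
          using that D(1) by (elim disjE) (simp_all add: k_def distrib_left right_diff_distrib, simp_all add: D_def algebra_simps)
        ultimately show "(k (C - B) *\<^sub>R A - k (C - A) *\<^sub>R B + k (B - A) *\<^sub>R C) $ i = v $ i"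
          using D(1) by auto
      qed
      then have "q = I + (k (C - B) *\<^sub>R A - k (C - A) *\<^sub>R B + k (B - A) *\<^sub>R C)"
        by (simp add: v_def)
      then show ?thesis by (simp add: I_def algebra_simps)
    qed
    ultimately show "q \<in> convex hull {A, B, C}"
      unfolding convex_hull_3 by blast
  qed
  then show ?thesis by blast
qed

lemma disk_radius_le_strip:
  fixes K :: "(real^2) set"
  assumes "\<And>x. x \<in> K \<Longrightarrow> \<bar>x$1 - m\<bar> \<le> S" "0 \<le> \<rho>" "cball c \<rho> \<subseteq> K"
  shows "\<rho> \<le> S"
proof -
  \<comment> \<open>The horizontal extremes of the disk differ by twice the radius in the first
    coordinate, while the strip has width \<open>2 * S\<close>.\<close>
  have "c + \<rho> *\<^sub>R axis 1 1 \<in> cball c \<rho>" "c - \<rho> *\<^sub>R axis 1 1 \<in> cball c \<rho>"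
    using assms(2) by (auto simp: dist_norm norm_axis_1)
  then have "\<bar>(c + \<rho> *\<^sub>R axis 1 1)$1 - m\<bar> \<le> S" "\<bar>(c - \<rho> *\<^sub>R axis 1 1)$1 - m\<bar> \<le> S"
    using assms by blast+
  then show ?thesis by (auto simp: axis_def)
qed

lemma inradius_le_strip:
  fixes K :: "(real^2) set"
  assumes "K \<noteq> {}" "\<And>x. x \<in> K \<Longrightarrow> \<bar>x$1 - m\<bar> \<le> S"
  shows "inradius K \<le> S"
  unfolding inradius_def
proof (rule cSup_least)
  obtain x where "x \<in> K" using assms(1) by auto
  then have "0 \<in> {\<rho>. 0 \<le> \<rho> \<and> (\<exists>c. cball c \<rho> \<subseteq> K)}" by (auto intro!: exI[of _ x])
  then show "{\<rho>. 0 \<le> \<rho> \<and> (\<exists>c. cball c \<rho> \<subseteq> K)} \<noteq> {}" by blast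
qed (use disk_radius_le_strip[OF assms(2)] in blast)

lemma bdd_above_disk_radii:
  fixes K :: "(real^2) set"
  assumes "bounded K"
  shows "bdd_above {\<rho>. 0 \<le> \<rho> \<and> (\<exists>c. cball c \<rho> \<subseteq> K)}"
proof -
  obtain S where S: "\<And>x. x \<in> K \<Longrightarrow> norm x \<le> S" using assms by (auto simp: bounded_iff)
  have "\<bar>x$1 - 0\<bar> \<le> S" if "x \<in> K" for x
    using S[OF that] component_le_norm_cart[of x 1] by simp
  from disk_radius_le_strip[OF this] show ?thesis by (auto intro!: bdd_aboveI)
qed

lemma inradius_ge:
  fixes K :: "(real^2) set"
  assumes "bounded K" "0 \<le> \<rho>" "cball c \<rho> \<subseteq> K"
  shows "\<rho> \<le> inradius K"
  unfolding inradius_def using assms by (intro cSup_upper bdd_above_disk_radii) auto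

text \<open>Measurability is tested on the sets where the inradius exceeds \<open>a\<close>, and a
  strict lower bound on a supremum is existential. For nonnegative \<open>a\<close> the sign
  condition on the radius is automatic.\<close>

lemma less_inradius_iff:
  fixes K :: "(real^2) set"
  assumes "bounded K" "K \<noteq> {}" "0 \<le> a"
  shows "a < inradius K \<longleftrightarrow> (\<exists>\<rho> c. a < \<rho> \<and> cball c \<rho> \<subseteq> K)"
proof -
  obtain x where "x \<in> K" using assms by auto
  then have "0 \<in> {\<rho>. 0 \<le> \<rho> \<and> (\<exists>c. cball c \<rho> \<subseteq> K)}" by (auto intro!: exI[of _ x])
  then have "{\<rho>. 0 \<le> \<rho> \<and> (\<exists>c. cball c \<rho> \<subseteq> K)} \<noteq> {}" by blast
  from less_cSup_iff[OF this bdd_above_disk_radii[OF assms(1)], of a]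
  have "a < inradius K \<longleftrightarrow> (\<exists>\<rho>. 0 \<le> \<rho> \<and> (\<exists>c. cball c \<rho> \<subseteq> K) \<and> a < \<rho>)"
    unfolding inradius_def by blast
  also have "\<dots> \<longleftrightarrow> (\<exists>\<rho> c. a < \<rho> \<and> cball c \<rho> \<subseteq> K)"
    using assms(3) by (meson less_imp_le order_trans)
  finally show ?thesis .
qed

section \<open>Measurability of the inradius\<close>

text \<open>A point outside \<open>H\<close> is strictly separated from it. Because \<open>H\<close>
  is bounded, the separation survives a small change of the normal, so normals from a dense set
  suffice.\<close>

lemma mem_compact_convex_iff_dense:
  fixes H D :: "(real^2) set"
  assumes H: "compact H" "convex H" "H \<noteq> {}"
    and D: "\<And>X :: (real^2) set. open X \<Longrightarrow> X \<noteq> {} \<Longrightarrow> \<exists>d\<in>D. d \<in> X"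
  shows "x \<in> H \<longleftrightarrow> (\<forall>u\<in>D. \<exists>y\<in>H. u \<bullet> x \<le> u \<bullet> y)"
proof
  assume R: "\<forall>u\<in>D. \<exists>y\<in>H. u \<bullet> x \<le> u \<bullet> y"
  show "x \<in> H"
  proof (rule ccontr)
    assume "x \<notin> H"
    then obtain a b where ab: "a \<bullet> x < b" "\<And>y. y \<in> H \<Longrightarrow> a \<bullet> y > b"
      using separating_hyperplane_closed_point[OF H(2) compact_imp_closed[OF H(1)]] by metis
    obtain S where S: "S > 0" "\<And>y. y \<in> H \<Longrightarrow> norm y \<le> S"
      using compact_imp_bounded[OF H(1)] by (auto simp: bounded_pos)
    \<comment> \<open>The gap divided by a bound for \<open>norm (y - x)\<close>: replacing
      \<open>- a\<close> by \<open>u\<close> then changes the inner product with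
      \<open>y - x\<close> by at most \<open>b - a \<bullet> x\<close>, which is less than
      \<open>a \<bullet> (y - x)\<close>.\<close>
    define e where "e = (b - a \<bullet> x) / (S + norm x)"
    have pos: "S + norm x > 0" using S by (simp add: add_pos_nonneg)
    have "e > 0" using ab pos by (simp add: e_def)
    then obtain u where u: "u \<in> D" "u \<in> ball (- a) e" using D[of "ball (-a) e"] by auto
    then have "norm (u + a) < e" by (simp add: dist_norm norm_minus_commute add.commute)
    obtain y where y: "y \<in> H" "u \<bullet> x \<le> u \<bullet> y" using R u by auto
    have "0 \<le> u \<bullet> (y - x)" using y by (simp add: inner_diff_right)
    also have "\<dots> = (u + a) \<bullet> (y - x) - a \<bullet> (y - x)" by (simp add: inner_add_left)
    also have "(u + a) \<bullet> (y - x) \<le> norm (u + a) * norm (y - x)" by (rule norm_cauchy_schwarz)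
    also have "\<dots> \<le> e * (S + norm x)"
      using \<open>e > 0\<close> \<open>norm (u + a) < e\<close> S(2)[OF y(1)] norm_triangle_ineq4[of y x] by (intro mult_mono) auto
    also have "\<dots> = b - a \<bullet> x" using pos by (simp add: e_def)
    finally show False using ab(2)[OF y(1)] by (simp add: inner_diff_right)
  qed
qed auto

text \<open>An open half-plane is convex, so once it contains \<open>K\<close> it contains the hull.
  This moves the test from the hull to the path.\<close>

lemma ex_inner_ge_convex_hull_iff:
  fixes K :: "(real^2) set"
  shows "(\<exists>y\<in>convex hull K. t \<le> u \<bullet> y) \<longleftrightarrow> (\<exists>y\<in>K. t \<le> u \<bullet> y)"
proof
  assume "\<exists>y\<in>convex hull K. t \<le> u \<bullet> y"
  then show "\<exists>y\<in>K. t \<le> u \<bullet> y"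
  proof (rule contrapos_pp)
    assume "\<not> (\<exists>y\<in>K. t \<le> u \<bullet> y)"
    then have "convex hull K \<subseteq> {y. u \<bullet> y < t}"
      by (intro hull_minimal) (auto simp: convex_halfspace_lt not_le)
    then show "\<not> (\<exists>y\<in>convex hull K. t \<le> u \<bullet> y)" by fastforce
  qed
qed (auto intro: hull_inc)

text \<open>The maximum is attained by compactness and approached along rational times by
  continuity. The slack \<open>1 / Suc n\<close> is there because it may be attained only at an
  irrational time.\<close>

lemma ex_ge_continuous_iff_rat:
  fixes f :: "real \<Rightarrow> real"
  assumes "continuous_on {0..1} f"
  shows "(\<exists>s\<in>{0..1}. t \<le> f s) \<longleftrightarrow> (\<forall>n::nat. \<exists>s\<in>{0..1}\<inter>\<rat>. t - 1 / Suc n < f s)"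
proof (intro iffI allI)
  fix n :: nat
  assume "\<exists>s\<in>{0..1}. t \<le> f s"
  then obtain s where s: "s \<in> {0..1}" "t \<le> f s" by auto
  have "t - 1 / Suc n < f s" using s by (intro less_le_trans[OF _ s(2)]) simp
  obtain d where d: "d > 0" "\<And>s'. s' \<in> {0..1} \<Longrightarrow> dist s' s < d \<Longrightarrow> dist (f s') (f s) < f s - (t - 1 / Suc n)"
    using assms s \<open>t - 1 / Suc n < f s\<close> unfolding continuous_on_iff by (metis diff_gt_0_iff_gt)
  \<comment> \<open>Clipping to the unit interval keeps the rational time admissible when
    \<open>s\<close> is an endpoint.\<close>
  have "max 0 (s - d) < min 1 (s + d)" using s d(1) by auto
  then obtain q where q: "q \<in> \<rat>" "max 0 (s - d) < q" "q < min 1 (s + d)"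
    using Rats_dense_in_real by blast
  then have "dist (f q) (f s) < f s - (t - 1 / Suc n)" by (intro d) (auto simp: dist_real_def)
  then show "\<exists>s\<in>{0..1}\<inter>\<rat>. t - 1 / Suc n < f s"
    using q by (intro bexI[of _ q]) (auto simp: dist_real_def abs_if split: if_splits)
next
  assume R: "\<forall>n::nat. \<exists>s\<in>{0..1}\<inter>\<rat>. t - 1 / Suc n < f s"
  obtain m where m: "m \<in> {0..1}" "\<And>s. s \<in> {0..1} \<Longrightarrow> f s \<le> f m"
    using continuous_attains_sup[OF _ _ assms] by auto
  have "t \<le> f m"
  proof (rule ccontr)
    assume "\<not> t \<le> f m"
    then obtain n where "inverse (real (Suc n)) < t - f m"
      using reals_Archimedean[of "t - f m"] by auto
    moreover obtain s where "s \<in> {0..1}" "t - 1 / Suc n < f s" using R by blast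
    ultimately show False using m(2)[of s] by (simp add: inverse_eq_divide)
  qed
  with m show "\<exists>s\<in>{0..1}. t \<le> f s" by auto
qed

text \<open>Combines the three preceding tests: dense normals, path points in place of hull points,
  rational times. What remains is a countable combination of events at single times.\<close>

lemma measurable_mem_convex_hull_path:
  fixes W :: "real \<Rightarrow> 'a \<Rightarrow> real^2"
  assumes meas: "\<And>t. 0 \<le> t \<Longrightarrow> W t \<in> borel_measurable M"
    and cont: "\<And>\<omega>. \<omega> \<in> space M \<Longrightarrow> continuous_on {0..1} (\<lambda>t. W t \<omega>)"
  shows "{\<omega>\<in>space M. x \<in> convex hull ((\<lambda>s. W s \<omega>) ` {0..1})} \<in> sets M"
proof -
  obtain D :: "(real^2) set" where D: "countable D" "\<And>X. open X \<Longrightarrow> X \<noteq> {} \<Longrightarrow> \<exists>d\<in>D. d \<in> X"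
    by (rule countable_dense_setE) blast
  have [measurable]: "W t \<in> borel_measurable M" if "t \<in> {0..1}\<inter>\<rat>" for t
    using meas that by auto
  have c: "countable ({0..1::real}\<inter>\<rat>)" by (simp add: countable_rat)
  have "{\<omega>\<in>space M. x \<in> convex hull ((\<lambda>s. W s \<omega>) ` {0..1})} =
    {\<omega>\<in>space M. \<forall>u\<in>D. \<forall>n::nat. \<exists>s\<in>{0..1}\<inter>\<rat>. u \<bullet> x - 1 / Suc n < u \<bullet> W s \<omega>}"
  proof (rule Collect_cong, rule conj_cong[OF refl])
    fix \<omega> assume \<omega>: "\<omega> \<in> space M"
    let ?K = "(\<lambda>s. W s \<omega>) ` {0..1}"
    have "compact ?K" by (intro compact_continuous_image cont[OF \<omega>]) simp
    then have "x \<in> convex hull ?K \<longleftrightarrow> (\<forall>u\<in>D. \<exists>y\<in>convex hull ?K. u \<bullet> x \<le> u \<bullet> y)"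
      by (intro mem_compact_convex_iff_dense D compact_convex_hull) auto
    also have "\<dots> \<longleftrightarrow> (\<forall>u\<in>D. \<exists>s\<in>{0..1}. u \<bullet> x \<le> u \<bullet> W s \<omega>)"
      unfolding ex_inner_ge_convex_hull_iff by simp
    also have "\<dots> \<longleftrightarrow> (\<forall>u\<in>D. \<forall>n::nat. \<exists>s\<in>{0..1}\<inter>\<rat>. u \<bullet> x - 1 / Suc n < u \<bullet> W s \<omega>)"
      by (intro ball_cong refl ex_ge_continuous_iff_rat continuous_intros cont[OF \<omega>])
    finally show "x \<in> convex hull ?K \<longleftrightarrow> \<dots>" .
  qed
  also have "\<dots> \<in> sets M"
    using D(1) c by measurable
  finally show ?thesis .
qed

text \<open>If the closed set \<open>H\<close> missed a point of the open ball, it would miss an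
  open set, which \<open>D\<close> meets. The test uses the open ball because \<open>D\<close> may
  avoid the bounding circle.\<close>

lemma cball_subset_iff_dense:
  fixes H D :: "(real^2) set"
  assumes H: "closed H" and "\<rho> > 0"
    and D: "\<And>X :: (real^2) set. open X \<Longrightarrow> X \<noteq> {} \<Longrightarrow> \<exists>d\<in>D. d \<in> X"
  shows "cball c \<rho> \<subseteq> H \<longleftrightarrow> (\<forall>x\<in>D \<inter> ball c \<rho>. x \<in> H)"
proof
  assume R: "\<forall>x\<in>D \<inter> ball c \<rho>. x \<in> H"
  have "ball c \<rho> \<subseteq> H"
  proof (rule ccontr)
    assume "\<not> ball c \<rho> \<subseteq> H"
    then have "open (ball c \<rho> - H)" "ball c \<rho> - H \<noteq> {}" using H by auto
    from D[OF this] R show False by auto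
  qed
  then show "cball c \<rho> \<subseteq> H"
    using closure_minimal[OF \<open>ball c \<rho> \<subseteq> H\<close> H] \<open>\<rho> > 0\<close> by simp
qed auto

lemma borel_measurable_inradius_path:
  fixes W :: "real \<Rightarrow> 'a \<Rightarrow> real^2"
  assumes meas: "\<And>t. 0 \<le> t \<Longrightarrow> W t \<in> borel_measurable M"
    and cont: "\<And>\<omega>. \<omega> \<in> space M \<Longrightarrow> continuous_on {0..1} (\<lambda>t. W t \<omega>)"
  shows "(\<lambda>\<omega>. inradius (convex hull ((\<lambda>s. W s \<omega>) ` {0..1}))) \<in> borel_measurable M"
proof (rule borel_measurableI_greater)
  fix a :: real
  let ?H = "\<lambda>\<omega>. convex hull ((\<lambda>s. W s \<omega>) ` {0..1})"
  have K: "compact (?H \<omega>)" if "\<omega> \<in> space M" for \<omega>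
    by (intro compact_convex_hull compact_continuous_image cont[OF that]) simp
  have ne: "?H \<omega> \<noteq> {}" for \<omega> by auto
  have "{\<omega>\<in>space M. a < inradius (?H \<omega>)} \<in> sets M"
  proof (cases "a < 0")
    \<comment> \<open>The existential criterion needs a nonnegative level; below 0 every path
      qualifies.\<close>
    case True
    have "a < inradius (?H \<omega>)" if "\<omega> \<in> space M" for \<omega>
    proof -
      have "0 \<le> inradius (?H \<omega>)"
        using ne[of \<omega>] by (intro inradius_ge[of _ 0 "W 0 \<omega>"] compact_imp_bounded K[OF that]) (auto intro!: hull_inc)
      with True show ?thesis by simp
    qed
    then have "{\<omega>\<in>space M. a < inradius (?H \<omega>)} = space M" by auto
    then show ?thesis by simp
  next
    case False
    obtain D :: "(real^2) set" where D: "countable D" "\<And>X. open X \<Longrightarrow> X \<noteq> {} \<Longrightarrow> \<exists>d\<in>D. d \<in> X"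
      by (rule countable_dense_setE) blast
    have "{\<omega>\<in>space M. a < inradius (?H \<omega>)} =
      {\<omega>\<in>space M. \<exists>\<rho>\<in>\<rat> \<inter> {a<..}. \<exists>c\<in>D. \<forall>x\<in>D \<inter> ball c \<rho>. x \<in> ?H \<omega>}"
    proof (rule Collect_cong, rule conj_cong[OF refl])
      fix \<omega> assume \<omega>: "\<omega> \<in> space M"
      have "a < inradius (?H \<omega>) \<longleftrightarrow> (\<exists>\<rho> c. a < \<rho> \<and> cball c \<rho> \<subseteq> ?H \<omega>)"
        using less_inradius_iff[OF compact_imp_bounded[OF K[OF \<omega>]] ne, of a] False by simp
      also have "\<dots> \<longleftrightarrow> (\<exists>\<rho>\<in>\<rat> \<inter> {a<..}. \<exists>c\<in>D. cball c \<rho> \<subseteq> ?H \<omega>)"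
      proof
        assume "\<exists>\<rho> c. a < \<rho> \<and> cball c \<rho> \<subseteq> ?H \<omega>"
        then obtain \<rho> c where \<rho>: "a < \<rho>" "cball c \<rho> \<subseteq> ?H \<omega>" by auto
        \<comment> \<open>Shrinking to a rational radius leaves room \<open>\<rho> - \<rho>'\<close>
          for moving the centre into \<open>D\<close>.\<close>
        obtain \<rho>' where \<rho>': "\<rho>' \<in> \<rat>" "a < \<rho>'" "\<rho>' < \<rho>" using Rats_dense_in_real[OF \<rho>(1)] by auto
        obtain c' where c': "c' \<in> D" "c' \<in> ball c (\<rho> - \<rho>')" using D(2)[of "ball c (\<rho> - \<rho>')"] \<rho>' by auto
        have "cball c' \<rho>' \<subseteq> cball c \<rho>"
        proof
          fix x assume "x \<in> cball c' \<rho>'"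
          then show "x \<in> cball c \<rho>" using c'(2) dist_triangle[of c x c'] by simp
        qed
        with \<rho> \<rho>' c' show "\<exists>\<rho>\<in>\<rat> \<inter> {a<..}. \<exists>c\<in>D. cball c \<rho> \<subseteq> ?H \<omega>" by blast
      qed auto
      also have "\<dots> \<longleftrightarrow> (\<exists>\<rho>\<in>\<rat> \<inter> {a<..}. \<exists>c\<in>D. \<forall>x\<in>D \<inter> ball c \<rho>. x \<in> ?H \<omega>)"
        using False by (intro bex_cong refl cball_subset_iff_dense D compact_imp_closed K[OF \<omega>]) auto
      finally show "a < inradius (?H \<omega>) \<longleftrightarrow> \<dots>" .
    qed
    also have "\<dots> \<in> sets M"
    proof -
      have [measurable]: "Measurable.pred M (\<lambda>\<omega>. x \<in> ?H \<omega>)" for x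
        using measurable_mem_convex_hull_path[OF meas cont] by (simp add: pred_def)
      have "countable (\<rat> \<inter> {a<..})" "\<And>c \<rho>. countable (D \<inter> ball c \<rho>)"
        using D(1) by (auto simp: countable_rat)
      with D(1) show ?thesis by measurable
    qed
    finally show ?thesis .
  qed
  then show "{\<omega>\<in>space M. a < inradius (?H \<omega>)} \<in> sets M" .
qed

section \<open>Integrability of the range of Brownian motion\<close>

text \<open>Serves to bound the largest of many increments by a deterministic part plus a sum of
  fourth powers. Squares would not do: \<open>2 ^ n\<close> increments of variance
  \<open>1 / 2 ^ n\<close> would contribute \<open>1 / \<epsilon> ^ n\<close> at level
  \<open>n\<close>, which is not summable when \<open>\<epsilon> < 1\<close>.\<close>

lemma abs_le_quartic:
  fixes x \<epsilon> :: real
  assumes "0 < \<epsilon>"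
  shows "\<bar>x\<bar> \<le> \<epsilon> + x ^ 4 / \<epsilon> ^ 3"
proof (cases "\<bar>x\<bar> \<le> \<epsilon>")
  case True
  have "0 \<le> x ^ 4 / \<epsilon> ^ 3" using assms by simp
  with True show ?thesis by linarith
next
  case False
  then have "\<bar>x\<bar> * \<epsilon> ^ 3 \<le> \<bar>x\<bar> * \<bar>x\<bar> ^ 3"
    using assms by (intro mult_left_mono power_mono) auto
  also have "\<dots> = \<bar>x\<bar> ^ 4" by (simp add: power_numeral_reduce)
  also have "\<dots> = x ^ 4" by (simp add: power_even_abs)
  finally have "\<bar>x\<bar> \<le> x ^ 4 / \<epsilon> ^ 3" using assms by (simp add: field_simps)
  with assms show ?thesis by linarith
qed

text \<open>Each level costs at most one increment: a point with even index already belongs to the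
  coarser level, and one with odd index lies one step to the right of such a point.\<close>

lemma dyadic_chain:
  fixes f :: "real \<Rightarrow> real"
  assumes step: "\<And>n k. k < 2 ^ n \<Longrightarrow> \<bar>f (real (Suc k) / 2 ^ n) - f (real k / 2 ^ n)\<bar> \<le> D n"
  shows "k \<le> 2 ^ n \<Longrightarrow> \<bar>f (real k / 2 ^ n) - f 0\<bar> \<le> (\<Sum>m\<le>n. D m)"
proof (induction n arbitrary: k)
  case 0
  then have "k = 0 \<or> k = 1" by auto
  moreover have "\<bar>f 1 - f 0\<bar> \<le> D 0" using step[of 0 0] by simp
  ultimately show ?case by (auto intro: order_trans[OF abs_ge_zero])
next
  case (Suc n)
  define j where "j = k div 2"
  have j: "j \<le> 2 ^ n" using Suc.prems by (simp add: j_def)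
  have half: "real (2 * j) / 2 ^ Suc n = real j / 2 ^ n" by simp
  show ?case
  proof (cases "even k")
    case True
    then have k: "k = 2 * j" by (simp add: j_def)
    have "0 \<le> D (Suc n)" using step[of 0 "Suc n"] by (auto intro: order_trans[OF abs_ge_zero])
    then show ?thesis using Suc.IH[OF j] unfolding k half by simp
  next
    case False
    then have k: "k = Suc (2 * j)" by (simp add: j_def)
    then have "2 * j < 2 ^ Suc n" using Suc.prems by linarith
    from step[OF this] have "\<bar>f (real k / 2 ^ Suc n) - f (real j / 2 ^ n)\<bar> \<le> D (Suc n)"
      unfolding k half .
    then show ?thesis using Suc.IH[OF j] by simp
  qed
qed

lemma dyadic_floor_tendsto:
  fixes t :: real
  assumes "0 \<le> t"
  shows "(\<lambda>n. real (nat \<lfloor>t * 2 ^ n\<rfloor>) / 2 ^ n) \<longlonglongrightarrow> t"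
proof (rule real_tendsto_sandwich)
  have fl: "real (nat \<lfloor>t * 2 ^ n\<rfloor>) = of_int \<lfloor>t * 2 ^ n\<rfloor>" for n using assms by simp
  show "\<forall>\<^sub>F n in sequentially. real (nat \<lfloor>t * 2 ^ n\<rfloor>) / 2 ^ n \<le> t"
  proof (rule always_eventually, rule allI)
    fix n
    show "real (nat \<lfloor>t * 2 ^ n\<rfloor>) / 2 ^ n \<le> t"
      unfolding fl using of_int_floor_le[of "t * 2 ^ n"] by (simp add: pos_divide_le_eq)
  qed
  show "\<forall>\<^sub>F n in sequentially. t - (1 / 2) ^ n \<le> real (nat \<lfloor>t * 2 ^ n\<rfloor>) / 2 ^ n"
  proof (rule always_eventually, rule allI)
    fix n
    have "(t - (1 / 2) ^ n) * 2 ^ n = t * 2 ^ n - 1"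
      by (simp add: left_diff_distrib flip: power_mult_distrib)
    also have "\<dots> \<le> of_int \<lfloor>t * 2 ^ n\<rfloor>" by linarith
    finally show "t - (1 / 2) ^ n \<le> real (nat \<lfloor>t * 2 ^ n\<rfloor>) / 2 ^ n"
      unfolding fl by (simp add: pos_le_divide_eq)
  qed
  have "(\<lambda>n. t - (1 / 2) ^ n) \<longlonglongrightarrow> t - 0"
    by (intro tendsto_intros LIMSEQ_power_zero) simp
  then show "(\<lambda>n. t - (1 / 2) ^ n) \<longlonglongrightarrow> t" by simp
qed simp

text \<open>The chain reaches the dyadic points just below \<open>t\<close>, and continuity passes
  to the limit. The bound lives in \<open>ennreal\<close>, so the series may diverge on exceptional
  paths.\<close>

lemma abs_le_dyadic_chain_suminf:
  fixes f :: "real \<Rightarrow> real"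
  assumes cont: "continuous_on {0..1} f" and t: "t \<in> {0..1}"
    and step: "\<And>n k. k < 2 ^ n \<Longrightarrow> \<bar>f (real (Suc k) / 2 ^ n) - f (real k / 2 ^ n)\<bar> \<le> D n"
  shows "ennreal \<bar>f t - f 0\<bar> \<le> (\<Sum>n. ennreal (D n))"
proof -
  define q where "q n = real (nat \<lfloor>t * 2 ^ n\<rfloor>) / 2 ^ n" for n
  have k: "nat \<lfloor>t * 2 ^ n\<rfloor> \<le> 2 ^ n" for n
  proof -
    have "t * 2 ^ n \<le> 1 * 2 ^ n" using t by (intro mult_right_mono) auto
    then have "\<lfloor>t * 2 ^ n\<rfloor> \<le> 2 ^ n" unfolding floor_le_iff of_int_power of_int_numeral by linarith
    then show ?thesis by (simp add: nat_le_iff)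
  qed
  have q01: "q n \<in> {0..1}" for n
  proof -
    have "real (nat \<lfloor>t * 2 ^ n\<rfloor>) \<le> 2 ^ n" using k[of n] by (metis of_nat_le_iff of_nat_numeral of_nat_power)
    then show ?thesis by (simp add: q_def)
  qed
  have D0: "0 \<le> D n" for n
    using step[of 0 n] by (auto intro: order_trans[OF abs_ge_zero])
  have "(\<lambda>n. f (q n)) \<longlonglongrightarrow> f t"
    using cont[unfolded continuous_on_sequentially, rule_format, of t q]
    using t q01 dyadic_floor_tendsto[of t] by (simp add: q_def[abs_def] comp_def)
  then have "(\<lambda>n. ennreal \<bar>f (q n) - f 0\<bar>) \<longlonglongrightarrow> ennreal \<bar>f t - f 0\<bar>"
    by (intro tendsto_intros)
  moreover have "ennreal \<bar>f (q n) - f 0\<bar> \<le> (\<Sum>n. ennreal (D n))" for n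
  proof -
    have "ennreal \<bar>f (q n) - f 0\<bar> \<le> ennreal (\<Sum>m\<le>n. D m)"
      using dyadic_chain[of f D, OF step k] unfolding q_def by (intro ennreal_leI) auto
    also have "\<dots> = (\<Sum>m\<le>n. ennreal (D m))" using D0 by (simp add: sum_ennreal)
    also have "\<dots> \<le> (\<Sum>n. ennreal (D n))" by (intro sum_le_suminf) auto
    finally show ?thesis .
  qed
  ultimately show ?thesis by (rule LIMSEQ_le_const2[OF _ exI[of _ 0, OF allI[OF impI]]])
qed

lemma nn_integral_normal_quartic:
  assumes "0 < \<sigma>" and X: "distributed M lborel X (\<lambda>x. ennreal (normal_density 0 \<sigma> x))"
  shows "(\<integral>\<^sup>+\<omega>. ennreal (X \<omega> ^ 4) \<partial>M) = ennreal (3 * \<sigma> ^ 4)"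
proof -
  have "has_bochner_integral lborel (\<lambda>x. normal_density 0 \<sigma> x * x ^ 4) (3 * \<sigma> ^ 4)"
    using normal_moment_even[OF assms(1), of 0 2]
    by (simp add: power_divide fact_numeral)
  then have "(\<integral>\<^sup>+x. ennreal (normal_density 0 \<sigma> x * x ^ 4) \<partial>lborel) = ennreal (3 * \<sigma> ^ 4)"
    by (subst nn_integral_eq_integral) (auto simp: has_bochner_integral_iff)
  then show ?thesis
    by (subst distributed_nn_integral[OF X, symmetric]) (auto simp: ennreal_mult)
qed

text \<open>
  Chaining over dyadic times. The fourth moments make the increments at level \<open>n\<close> contribute
  \<open>\<epsilon>\<^sup>n + 3 (2 \<epsilon>\<^sup>3)\<^sup>-\<^sup>n\<close> on average, which is summable for \<open>\<epsilon> = 9/10\<close>.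
\<close>

lemma (in standard_brownian_motion) integrable_range_bound:
  obtains S where "S \<in> borel_measurable M" "(\<integral>\<^sup>+\<omega>. S \<omega> \<partial>M) < \<infinity>"
    "\<And>\<omega> t. \<omega> \<in> space M \<Longrightarrow> t \<in> {0..1} \<Longrightarrow> ennreal \<bar>B t \<omega> - B 0 \<omega>\<bar> \<le> S \<omega>"
proof -
  \<comment> \<open>Both geometric series converge for any value strictly between the cube root of
    1/2, about 0.794, and 1.\<close>
  define \<epsilon> :: real where "\<epsilon> = 9 / 10"
  define X where "X n k \<omega> = B (real (Suc k) / 2 ^ n) \<omega> - B (real k / 2 ^ n) \<omega>" for n k \<omega>
  \<comment> \<open>Summing over all \<open>k\<close> controls every increment of the level at once,
    so no maximum has to be estimated.\<close>
  define D where "D n \<omega> = \<epsilon> ^ n + (\<Sum>k<2^n. X n k \<omega> ^ 4) / (\<epsilon> ^ n) ^ 3" for n \<omega>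
  define S where "S \<omega> = (\<Sum>n. ennreal (D n \<omega>))" for \<omega>
  have [measurable]: "X n k \<in> borel_measurable M" for n k
    unfolding X_def by (intro borel_measurable_diff measurable_at) auto
  have [measurable]: "D n \<in> borel_measurable M" for n unfolding D_def by measurable
  have S: "S \<in> borel_measurable M" unfolding S_def by measurable
  have step: "\<bar>X n k \<omega>\<bar> \<le> D n \<omega>" if "k < 2 ^ n" for n k \<omega>
  proof -
    have "\<bar>X n k \<omega>\<bar> \<le> \<epsilon> ^ n + X n k \<omega> ^ 4 / (\<epsilon> ^ n) ^ 3"
      by (intro abs_le_quartic) (simp add: \<epsilon>_def)
    also have "\<dots> \<le> D n \<omega>" unfolding D_def
      using that by (intro add_left_mono divide_right_mono member_le_sum) (auto simp: \<epsilon>_def)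
    finally show ?thesis .
  qed
  have bound: "ennreal \<bar>B t \<omega> - B 0 \<omega>\<bar> \<le> S \<omega>" if "\<omega> \<in> space M" "t \<in> {0..1}" for \<omega> t
    unfolding S_def using step unfolding X_def
    by (intro abs_le_dyadic_chain_suminf[OF continuous_on_subset[OF continuous_paths[OF that(1)]]] that) auto
  have ED: "(\<integral>\<^sup>+\<omega>. ennreal (D n \<omega>) \<partial>M) = ennreal (\<epsilon> ^ n + 3 * (1 / (2 * \<epsilon> ^ 3)) ^ n)" for n
  proof -
    have m: "(\<integral>\<^sup>+\<omega>. ennreal (X n k \<omega> ^ 4) \<partial>M) = ennreal (3 / 4 ^ n)" for k
    proof -
      have "distributed M lborel (X n k) (\<lambda>x. ennreal (normal_density 0 (sqrt (1 / 2 ^ n)) x))"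
        using gaussian_increments[of "real k / 2 ^ n" "real (Suc k) / 2 ^ n"]
        unfolding X_def by (simp add: divide_strict_right_mono diff_divide_distrib[symmetric])
      then have "(\<integral>\<^sup>+\<omega>. ennreal (X n k \<omega> ^ 4) \<partial>M) = ennreal (3 * sqrt (1 / 2 ^ n) ^ 4)"
        by (rule nn_integral_normal_quartic[rotated]) simp
      also have "sqrt (1 / 2 ^ n) ^ 4 = ((sqrt (1 / 2 ^ n))\<^sup>2)\<^sup>2"
        by (simp only: power_mult[symmetric]) simp
      also have "\<dots> = 1 / (2 ^ n * 2 ^ n)"
        by (simp add: power2_eq_square)
      also have "(2::real) ^ n * 2 ^ n = 4 ^ n" by (simp flip: power_mult_distrib)
      finally show ?thesis by simp
    qed
    have "ennreal (D n \<omega>) = ennreal (\<epsilon> ^ n) + ennreal (1 / (\<epsilon> ^ n) ^ 3) * (\<Sum>k<2^n. ennreal (X n k \<omega> ^ 4))" for \<omega>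
      unfolding D_def by (simp add: sum_nonneg \<epsilon>_def ennreal_plus sum_ennreal flip: ennreal_mult)
    then have "(\<integral>\<^sup>+\<omega>. ennreal (D n \<omega>) \<partial>M) =
      ennreal (\<epsilon> ^ n) + ennreal (1 / (\<epsilon> ^ n) ^ 3) * (\<Sum>k<2^n. (\<integral>\<^sup>+\<omega>. ennreal (X n k \<omega> ^ 4) \<partial>M))"
      by (simp add: nn_integral_add nn_integral_cmult nn_integral_sum emeasure_space_1 del: sum_ennreal)
    also have "(\<Sum>k<2^n. (\<integral>\<^sup>+\<omega>. ennreal (X n k \<omega> ^ 4) \<partial>M)) = ennreal (2 ^ n * (3 / 4 ^ n))"
      unfolding m by (subst sum_ennreal) auto
    also have "ennreal (\<epsilon> ^ n) + ennreal (1 / (\<epsilon> ^ n) ^ 3) * ennreal (2 ^ n * (3 / 4 ^ n))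
        = ennreal (\<epsilon> ^ n + 1 / (\<epsilon> ^ n) ^ 3 * (2 ^ n * (3 / 4 ^ n)))"
      by (subst ennreal_mult[symmetric], simp add: \<epsilon>_def, simp, rule ennreal_plus[symmetric]) (auto simp: \<epsilon>_def)
    also have "1 / (\<epsilon> ^ n) ^ 3 * (2 ^ n * (3 / 4 ^ n)) = 3 * (1 / (2 * \<epsilon> ^ 3)) ^ n"
    proof -
      have "(4::real) ^ n = 2 ^ n * 2 ^ n" by (simp flip: power_mult_distrib)
      moreover have "(\<epsilon> ^ n) ^ 3 = (\<epsilon> ^ 3) ^ n" by (simp add: mult.commute flip: power_mult)
      ultimately show ?thesis by (simp add: power_divide power_mult_distrib)
    qed
    finally show ?thesis .
  qed
  have "(\<integral>\<^sup>+\<omega>. S \<omega> \<partial>M) = (\<Sum>n. ennreal (\<epsilon> ^ n + 3 * (1 / (2 * \<epsilon> ^ 3)) ^ n))"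
    unfolding S_def by (subst nn_integral_suminf) (auto simp: ED)
  also have "\<dots> < \<infinity>"
  proof -
    have "summable (\<lambda>n. \<epsilon> ^ n + 3 * (1 / (2 * \<epsilon> ^ 3)) ^ n)"
      by (intro summable_add summable_mult summable_geometric) (auto simp: \<epsilon>_def power_numeral_reduce)
    then show ?thesis by (subst suminf_ennreal2) (auto simp: \<epsilon>_def)
  qed
  finally show ?thesis using that[OF S _ bound] by blast
qed

section \<open>Gaussian integrals\<close>

definition gaussian :: "real \<Rightarrow> real measure" where
  "gaussian \<sigma> = density lborel (\<lambda>x. ennreal (normal_density 0 \<sigma> x))"

lemma sets_gaussian [simp, measurable_cong]: "sets (gaussian \<sigma>) = sets borel"
  by (simp add: gaussian_def)

lemma space_gaussian [simp]: "space (gaussian \<sigma>) = UNIV"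
  by (simp add: gaussian_def)

lemma prob_space_gaussian: "0 < \<sigma> \<Longrightarrow> prob_space (gaussian \<sigma>)"
  unfolding gaussian_def by (rule prob_space_normal_density)

text \<open>Translates density statements into equalities of laws, the form in which independence
  yields product measures.\<close>

lemma distributed_gaussian_iff:
  "distributed M lborel X (\<lambda>x. ennreal (normal_density 0 \<sigma> x)) \<longleftrightarrow>
    X \<in> borel_measurable M \<and> distr M borel X = gaussian \<sigma>"
proof -
  have "distr M lborel X = distr M borel X" by (rule distr_cong) auto
  then show ?thesis by (auto simp: distributed_def gaussian_def)
qed

lemma nn_integral_gaussian:
  assumes [measurable]: "f \<in> borel_measurable borel"
  shows "(\<integral>\<^sup>+x. f x \<partial>gaussian \<sigma>) = (\<integral>\<^sup>+x. ennreal (normal_density 0 \<sigma> x) * f x \<partial>lborel)"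
  unfolding gaussian_def by (subst nn_integral_density) auto

lemma nn_integral_gaussian_uminus:
  assumes [measurable]: "f \<in> borel_measurable borel"
  shows "(\<integral>\<^sup>+x. f (- x) \<partial>gaussian \<sigma>) = (\<integral>\<^sup>+x. f x \<partial>gaussian \<sigma>)"
proof -
  have "(\<integral>\<^sup>+x. f x \<partial>gaussian \<sigma>) = (\<integral>\<^sup>+x. ennreal (normal_density 0 \<sigma> (0 + -1 * x)) * f (0 + -1 * x) \<partial>lborel)"
    by (subst nn_integral_gaussian, simp, subst nn_integral_real_affine[where c = "-1" and t = 0]) auto
  also have "\<dots> = (\<integral>\<^sup>+x. f (- x) \<partial>gaussian \<sigma>)"
    by (subst nn_integral_gaussian) (auto simp: normal_density_def)
  finally show ?thesis by simp
qed

lemma AE_gaussian_neq: "AE x in gaussian \<sigma>. x \<noteq> c"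
  unfolding gaussian_def by (subst AE_density) (use AE_lborel_singleton[of c] in auto)

text \<open>At variance 1/2 the density is exp (- x^2) up to a constant, so the tilt only changes
  the coefficient in the exponent to 1 + s^2. The outer factor is the ratio of the normalising
  constants.\<close>

lemma nn_integral_gaussian_tilt:
  assumes [measurable]: "f \<in> borel_measurable borel"
  shows "(\<integral>\<^sup>+x. ennreal (exp (- (s\<^sup>2 * x\<^sup>2))) * f x \<partial>gaussian (sqrt (1 / 2))) =
    ennreal (1 / sqrt (1 + s\<^sup>2)) * (\<integral>\<^sup>+x. f x \<partial>gaussian (sqrt (1 / (2 * (1 + s\<^sup>2)))))"
proof -
  have p: "1 + s\<^sup>2 > 0" "2 + 2 * s\<^sup>2 \<noteq> 0" by (simp_all add: add_pos_nonneg add_nonneg_eq_0_iff)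
  have "normal_density 0 (sqrt (1 / 2)) x * exp (- (s\<^sup>2 * x\<^sup>2)) =
      1 / sqrt (1 + s\<^sup>2) * normal_density 0 (sqrt (1 / (2 * (1 + s\<^sup>2)))) x" for x
  proof -
    have "- x\<^sup>2 / (2 * (sqrt (1 / 2))\<^sup>2) + - (s\<^sup>2 * x\<^sup>2) = - x\<^sup>2 / (2 * (sqrt (1 / (2 * (1 + s\<^sup>2))))\<^sup>2)"
      using p by (simp add: field_simps)
    moreover have "sqrt (2 * pi * (sqrt (1 / 2))\<^sup>2) = sqrt (1 + s\<^sup>2) * sqrt (2 * pi * (sqrt (1 / (2 * (1 + s\<^sup>2))))\<^sup>2)"
      using p by (simp add: real_sqrt_mult[symmetric]) (simp add: field_simps)
    ultimately show ?thesis
      using p unfolding normal_density_def by (simp add: exp_add[symmetric])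
  qed
  then show ?thesis
    using p by (simp add: nn_integral_gaussian nn_integral_cmult[symmetric] mult.assoc[symmetric] ennreal_mult'[symmetric])
qed

section \<open>Improper integrals over the real line\<close>

lemma nn_integral_even_FTC:
  fixes f F :: "real \<Rightarrow> real"
  assumes [measurable]: "f \<in> borel_measurable borel"
    and even: "\<And>x. f (- x) = f x" and nonneg: "\<And>x. 0 \<le> f x"
    and F: "\<And>x. (F has_real_derivative f x) (at x)" and lim: "(F \<longlongrightarrow> T) at_top"
  shows "(\<integral>\<^sup>+x. ennreal (f x) \<partial>lborel) = ennreal (2 * (T - F 0))"
proof -
  have half: "(\<integral>\<^sup>+x. ennreal (f x) * indicator {0..} x \<partial>lborel) = ennreal (T - F 0)"
    by (rule nn_integral_FTC_atLeast) (use assms in auto)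
  have "(\<integral>\<^sup>+x. ennreal (f x) * indicator {..0} x \<partial>lborel)
      = (\<integral>\<^sup>+x. ennreal (f (0 + -1 * x)) * indicator {..0} (0 + -1 * x) \<partial>lborel)"
    by (subst nn_integral_real_affine[where c = "-1" and t = 0]) auto
  also have "\<dots> = ennreal (T - F 0)"
    unfolding half[symmetric] by (intro nn_integral_cong) (auto simp: even indicator_def)
  finally have half': "(\<integral>\<^sup>+x. ennreal (f x) * indicator {..0} x \<partial>lborel) = ennreal (T - F 0)" .
  have "F 0 \<le> F x" if "0 \<le> x" for x
    by (rule DERIV_nonneg_imp_nondecreasing[OF that]) (rule exI, rule conjI[OF F nonneg])
  then have "\<forall>\<^sub>F x in at_top. F 0 \<le> F x" by (rule eventually_at_top_linorderI)
  from tendsto_lowerbound[OF lim this] have "0 \<le> T - F 0" by simp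
  have "(\<integral>\<^sup>+x. ennreal (f x) \<partial>lborel) =
    (\<integral>\<^sup>+x. ennreal (f x) * indicator {0..} x + ennreal (f x) * indicator {..0} x \<partial>lborel)"
    \<comment> \<open>Both half-lines contain 0; the overlap is a null set.\<close>
    by (rule nn_integral_cong_AE, rule AE_mp[OF AE_lborel_singleton[of 0]]) (auto simp: indicator_def)
  also have "\<dots> = ennreal (T - F 0) + ennreal (T - F 0)"
    by (simp add: nn_integral_add half half')
  finally show ?thesis using \<open>0 \<le> T - F 0\<close> by (simp flip: ennreal_plus)
qed

lemma nn_integral_inverse_square_plus_1:
  "(\<integral>\<^sup>+u. ennreal (1 / (1 + u\<^sup>2)) \<partial>lborel) = ennreal pi"
proof -
  have "(\<integral>\<^sup>+u. ennreal (1 / (1 + u\<^sup>2)) \<partial>lborel) = ennreal (2 * (pi / 2 - arctan 0))"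
    by (intro nn_integral_even_FTC tendsto_arctan_at_top)
      (auto intro!: derivative_eq_intros simp: inverse_eq_divide)
  then show ?thesis by simp
qed

lemma nn_integral_inverse_cube_square_plus_1:
  "(\<integral>\<^sup>+u. ennreal (1 / (1 + u\<^sup>2) ^ 3) \<partial>lborel) = ennreal (3 * pi / 8)"
proof -
  \<comment> \<open>Two applications of the reduction formula for the integral of 1 / (1 +
    u^2)^n.\<close>
  define F :: "real \<Rightarrow> real"
    where "F u = u / (4 * (1 + u\<^sup>2)\<^sup>2) + 3 * u / (8 * (1 + u\<^sup>2)) + 3 / 8 * arctan u" for u
  have "(F has_real_derivative 1 / (1 + u\<^sup>2) ^ 3) (at u)" for u
  proof -
    have p: "1 + u\<^sup>2 \<noteq> 0" by (metis add_pos_nonneg less_irrefl zero_le_power2 zero_less_one)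
    define q where "q = 1 + u\<^sup>2"
    have u2: "u\<^sup>2 = q - 1" by (simp add: q_def)
    have 1: "((\<lambda>u. u / (4 * (1 + u\<^sup>2)\<^sup>2)) has_real_derivative (1 / (4 * q\<^sup>2) - u\<^sup>2 / q ^ 3)) (at u)"
      unfolding q_def using p
      by (auto intro!: derivative_eq_intros simp: divide_simps) (simp add: algebra_simps power_numeral_reduce)
    have 2: "((\<lambda>u. 3 * u / (8 * (1 + u\<^sup>2))) has_real_derivative (3 / (8 * q) - 3 * u\<^sup>2 / (4 * q\<^sup>2))) (at u)"
      unfolding q_def using p
      by (auto intro!: derivative_eq_intros simp: divide_simps) (simp add: algebra_simps power_numeral_reduce)
    have 3: "((\<lambda>u. 3 / 8 * arctan u) has_real_derivative 3 / (8 * q)) (at u)"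
      unfolding q_def by (auto intro!: derivative_eq_intros simp: divide_simps)
    have "q \<noteq> 0" using p by (simp add: q_def)
    then have "1 / (4 * q\<^sup>2) - u\<^sup>2 / q ^ 3 + (3 / (8 * q) - 3 * u\<^sup>2 / (4 * q\<^sup>2)) + 3 / (8 * q) = 1 / q ^ 3"
      unfolding u2 by (simp add: divide_simps) (simp add: algebra_simps power_numeral_reduce)
    with DERIV_add[OF DERIV_add[OF 1 2] 3] show ?thesis
      unfolding F_def[abs_def] q_def by simp
  qed
  moreover have "(F \<longlongrightarrow> 0 + 0 + 3 / 8 * (pi / 2)) at_top"
    unfolding F_def by (intro tendsto_add tendsto_mult tendsto_const tendsto_arctan_at_top; real_asymp)
  ultimately have "(\<integral>\<^sup>+u. ennreal (1 / (1 + u\<^sup>2) ^ 3) \<partial>lborel) = ennreal (2 * ((0 + 0 + 3 / 8 * (pi / 2)) - F 0))"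
    by (intro nn_integral_even_FTC) auto
  then show ?thesis by (simp add: F_def)
qed

text \<open>The integrand is a multiple of the normal density in \<open>s\<close> with variance 1 /
  (2 h^2). Read backwards, this represents 1 / h by exponentials of h^2.\<close>

lemma nn_integral_exp_square:
  assumes "0 < h"
  shows "(\<integral>\<^sup>+s. ennreal (exp (- (s\<^sup>2 * h\<^sup>2))) \<partial>lborel) = ennreal (sqrt pi / h)"
proof -
  define \<sigma> where "\<sigma> = 1 / (sqrt 2 * h)"
  have \<sigma>: "\<sigma> > 0" using assms by (simp add: \<sigma>_def)
  have \<sigma>2: "2 * \<sigma>\<^sup>2 = 1 / h\<^sup>2" using assms by (simp add: \<sigma>_def power_divide power_mult_distrib)
  have "exp (- (s\<^sup>2 * h\<^sup>2)) = sqrt pi / h * normal_density 0 \<sigma> s" for s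
  proof -
    have "2 * pi * \<sigma>\<^sup>2 = pi / h\<^sup>2" using \<sigma>2 by (simp add: field_simps)
    then have "sqrt (2 * pi * \<sigma>\<^sup>2) = sqrt pi / h" using assms by (simp add: real_sqrt_divide)
    then show ?thesis unfolding normal_density_def \<sigma>2 using assms by simp
  qed
  then have "(\<integral>\<^sup>+s. ennreal (exp (- (s\<^sup>2 * h\<^sup>2))) \<partial>lborel) =
      ennreal (sqrt pi / h) * (\<integral>\<^sup>+s. ennreal (normal_density 0 \<sigma> s) \<partial>lborel)"
    using assms by (simp add: nn_integral_cmult[symmetric] ennreal_mult'[symmetric])
  also have "(\<integral>\<^sup>+s. ennreal (normal_density 0 \<sigma> s) \<partial>lborel) = 1"
    using integral_normal_density[OF \<sigma>, of 0] by (subst nn_integral_eq_integral) (auto simp: \<sigma>)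
  finally show ?thesis by simp
qed

lemma nn_integral_normal_square:
  assumes "0 < \<sigma>"
  shows "(\<integral>\<^sup>+x. ennreal (normal_density 0 \<sigma> x * x\<^sup>2) \<partial>lborel) = ennreal (\<sigma>\<^sup>2)"
proof -
  have "has_bochner_integral lborel (\<lambda>x. normal_density 0 \<sigma> x * x\<^sup>2) (\<sigma>\<^sup>2)"
    using normal_moment_even[OF assms(1), of 0 1] by simp
  then show ?thesis
    by (subst nn_integral_eq_integral) (auto simp: has_bochner_integral_iff)
qed

section \<open>Gaussian expectations of linear forms, norms and determinants\<close>

lemma nn_integral_gaussian_abs:
  assumes "0 < \<sigma>"
  shows "(\<integral>\<^sup>+x. ennreal \<bar>x\<bar> \<partial>gaussian \<sigma>) = ennreal (\<sigma> * sqrt (2 / pi))"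
proof -
  have "has_bochner_integral lborel (\<lambda>x. normal_density 0 \<sigma> x * \<bar>x\<bar>) (\<sigma> * sqrt (2 / pi))"
    using normal_moment_abs_odd[OF assms(1), of 0 0] by simp
  then have "(\<integral>\<^sup>+x. ennreal (normal_density 0 \<sigma> x * \<bar>x\<bar>) \<partial>lborel) = ennreal (\<sigma> * sqrt (2 / pi))"
    by (subst nn_integral_eq_integral) (auto simp: has_bochner_integral_iff)
  then show ?thesis by (simp add: nn_integral_gaussian ennreal_mult)
qed

text \<open>With fixed coefficients the linear form is a sum of independent centred normals, hence
  normal with variance \<sigma>^2 (a^2 + b^2). Nonzero coefficients keep both summands
  nondegenerate; in the application the excluded values form a null set.\<close>

lemma nn_integral_gaussian_linear_abs:
  fixes a b :: real
  assumes \<sigma>: "0 < \<sigma>" and ab: "a \<noteq> 0" "b \<noteq> 0"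
  shows "(\<integral>\<^sup>+x. \<integral>\<^sup>+y. ennreal \<bar>a * y - b * x\<bar> \<partial>gaussian \<sigma> \<partial>gaussian \<sigma>) =
    ennreal (\<sigma> * sqrt (2 / pi) * sqrt (a\<^sup>2 + b\<^sup>2))"
proof -
  let ?N = "gaussian \<sigma>" and ?P = "gaussian \<sigma> \<Otimes>\<^sub>M gaussian \<sigma>"
  interpret N: prob_space ?N using \<sigma> by (rule prob_space_gaussian)
  interpret P: pair_prob_space ?N ?N ..
  have fst: "distr ?P borel fst = ?N"
  proof -
    have "distr ?P borel fst = distr ?P ?N fst" by (rule distr_cong) auto
    then show ?thesis by (simp add: N.distr_pair_fst)
  qed
  have snd: "distr ?P borel snd = ?N"
  proof -
    have "distr ?P borel snd = distr (distr ?P ?P (\<lambda>(x, y). (y, x))) borel fst"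
      by (subst distr_distr) (auto simp: comp_def case_prod_beta)
    also have "distr ?P ?P (\<lambda>(x, y). (y, x)) = ?P" by (rule P.distr_pair_swap[symmetric])
    finally show ?thesis using fst by simp
  qed
  have indep: "P.indep_var borel fst borel snd"
  proof -
    have "distr ?P (borel \<Otimes>\<^sub>M borel) (\<lambda>x. (fst x, snd x)) = distr ?P ?P (\<lambda>x. x)"
      by (rule distr_cong) (auto intro!: sets_pair_measure_cong)
    then show ?thesis by (simp add: P.indep_var_distribution_eq fst snd distr_id2)
  qed
  have "P.indep_var borel ((\<lambda>x. - b * x) \<circ> fst) borel ((\<lambda>y. a * y) \<circ> snd)"
    by (rule P.indep_var_compose[OF indep]) auto
  then have ind: "P.indep_var borel (\<lambda>p. - b * fst p) borel (\<lambda>p. a * snd p)"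
    by (simp add: comp_def)
  have "distributed ?P lborel fst (\<lambda>x. ennreal (normal_density 0 \<sigma> x))"
    "distributed ?P lborel snd (\<lambda>x. ennreal (normal_density 0 \<sigma> x))"
    unfolding distributed_gaussian_iff by (auto simp: fst snd)
  from P.normal_density_affine[OF this(1), of "- b" 0] P.normal_density_affine[OF this(2), of a 0]
  have "distributed ?P lborel (\<lambda>p. - b * fst p) (\<lambda>x. ennreal (normal_density 0 (\<bar>b\<bar> * \<sigma>) x))"
    "distributed ?P lborel (\<lambda>p. a * snd p) (\<lambda>x. ennreal (normal_density 0 (\<bar>a\<bar> * \<sigma>) x))"
    using \<sigma> ab by simp_all
  from P.add_indep_normal[OF ind _ _ this]
  have "distributed ?P lborel (\<lambda>p. - b * fst p + a * snd p)
      (\<lambda>x. ennreal (normal_density 0 (sqrt ((\<bar>b\<bar> * \<sigma>)\<^sup>2 + (\<bar>a\<bar> * \<sigma>)\<^sup>2)) x))"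
    using \<sigma> ab by simp
  also have "sqrt ((\<bar>b\<bar> * \<sigma>)\<^sup>2 + (\<bar>a\<bar> * \<sigma>)\<^sup>2) = \<sigma> * sqrt (a\<^sup>2 + b\<^sup>2)"
  proof -
    have "(\<bar>b\<bar> * \<sigma>)\<^sup>2 + (\<bar>a\<bar> * \<sigma>)\<^sup>2 = \<sigma>\<^sup>2 * (a\<^sup>2 + b\<^sup>2)" by (simp add: power_mult_distrib algebra_simps)
    then show ?thesis using \<sigma> by (simp add: real_sqrt_mult)
  qed
  finally have "distr ?P borel (\<lambda>p. - b * fst p + a * snd p) = gaussian (\<sigma> * sqrt (a\<^sup>2 + b\<^sup>2))"
    unfolding distributed_gaussian_iff by simp
  then have "(\<integral>\<^sup>+x. ennreal \<bar>x\<bar> \<partial>gaussian (\<sigma> * sqrt (a\<^sup>2 + b\<^sup>2))) =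
      (\<integral>\<^sup>+p. ennreal \<bar>- b * fst p + a * snd p\<bar> \<partial>?P)"
    by (subst nn_integral_distr[symmetric, where f = "\<lambda>x. ennreal \<bar>x\<bar>" and M' = borel]) auto
  also have "\<dots> = (\<integral>\<^sup>+x. \<integral>\<^sup>+y. ennreal \<bar>a * y - b * x\<bar> \<partial>?N \<partial>?N)"
    by (subst N.nn_integral_fst[symmetric]) (auto intro!: nn_integral_cong)
  finally have "(\<integral>\<^sup>+x. \<integral>\<^sup>+y. ennreal \<bar>a * y - b * x\<bar> \<partial>?N \<partial>?N) =
      (\<integral>\<^sup>+x. ennreal \<bar>x\<bar> \<partial>gaussian (\<sigma> * sqrt (a\<^sup>2 + b\<^sup>2)))" ..
  also have "\<dots> = ennreal (\<sigma> * sqrt (a\<^sup>2 + b\<^sup>2) * sqrt (2 / pi))"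
    using \<sigma> ab by (intro nn_integral_gaussian_abs) (simp add: add_pos_pos)
  finally show ?thesis by (simp add: mult_ac)
qed

text \<open>The substitution \<open>y = x u\<close> replaces polar coordinates.\<close>

lemma nn_integral_gaussian_norm:
  assumes \<sigma>: "0 < \<sigma>"
  shows "(\<integral>\<^sup>+x. \<integral>\<^sup>+y. ennreal (sqrt (x\<^sup>2 + y\<^sup>2)) \<partial>gaussian \<sigma> \<partial>gaussian \<sigma>) = ennreal (\<sigma> * sqrt (pi / 2))"
proof -
  \<comment> \<open>After the substitution the two exponents merge into - x^2 (1 + u^2) / (2
    \<sigma>^2), a normal density in \<open>x\<close> with deviation \<open>\<tau> u\<close>. The
    integral over \<open>x\<close> becomes a second moment, and a multiple of 1 / (1 + u^2) is left
    for \<open>u\<close>.\<close>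
  define \<tau> where "\<tau> u = \<sigma> / sqrt (1 + u\<^sup>2)" for u
  have p: "1 + u\<^sup>2 > 0" for u :: real by (simp add: add_pos_nonneg)
  have \<tau>: "\<tau> u > 0" for u using \<sigma> p by (simp add: \<tau>_def)
  have [measurable]: "\<tau> \<in> borel_measurable borel" unfolding \<tau>_def by measurable
  have sub: "ennreal (normal_density 0 \<sigma> x) * (\<integral>\<^sup>+y. ennreal (sqrt (x\<^sup>2 + y\<^sup>2)) \<partial>gaussian \<sigma>) =
      (\<integral>\<^sup>+u. ennreal (1 / sqrt (2 * pi * \<sigma>\<^sup>2)) * (ennreal (normal_density 0 (\<tau> u) x * x\<^sup>2) * ennreal 1) \<partial>lborel)"
    if x: "x \<noteq> 0" for x
  proof -
    have "(\<integral>\<^sup>+y. ennreal (sqrt (x\<^sup>2 + y\<^sup>2)) \<partial>gaussian \<sigma>) =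
        (\<integral>\<^sup>+y. ennreal (normal_density 0 \<sigma> y * sqrt (x\<^sup>2 + y\<^sup>2)) \<partial>lborel)"
      by (simp add: nn_integral_gaussian ennreal_mult)
    also have "\<dots> = ennreal \<bar>x\<bar> * (\<integral>\<^sup>+u. ennreal (normal_density 0 \<sigma> (0 + x * u) * sqrt (x\<^sup>2 + (0 + x * u)\<^sup>2)) \<partial>lborel)"
      by (rule nn_integral_real_affine) (use x in auto)
    finally have *: "(\<integral>\<^sup>+y. ennreal (sqrt (x\<^sup>2 + y\<^sup>2)) \<partial>gaussian \<sigma>) =
        (\<integral>\<^sup>+u. ennreal (\<bar>x\<bar> * (normal_density 0 \<sigma> (x * u) * sqrt (x\<^sup>2 + (x * u)\<^sup>2))) \<partial>lborel)"
      by (simp add: nn_integral_cmult[symmetric] ennreal_mult[symmetric])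
    have "normal_density 0 \<sigma> x * (\<bar>x\<bar> * (normal_density 0 \<sigma> (x * u) * sqrt (x\<^sup>2 + (x * u)\<^sup>2))) =
       1 / sqrt (2 * pi * \<sigma>\<^sup>2) * (normal_density 0 (\<tau> u) x * x\<^sup>2)" for u
    proof -
      have 1: "sqrt (x\<^sup>2 + (x * u)\<^sup>2) = \<bar>x\<bar> * sqrt (1 + u\<^sup>2)"
      proof -
        have "x\<^sup>2 + (x * u)\<^sup>2 = x\<^sup>2 * (1 + u\<^sup>2)" by (simp add: power_mult_distrib algebra_simps)
        then show ?thesis by (simp add: real_sqrt_mult)
      qed
      have t2: "(\<tau> u)\<^sup>2 = \<sigma>\<^sup>2 / (1 + u\<^sup>2)" using p[of u] by (simp add: \<tau>_def power_divide)
      have 2: "- x\<^sup>2 / (2 * \<sigma>\<^sup>2) + - (x * u)\<^sup>2 / (2 * \<sigma>\<^sup>2) = - x\<^sup>2 / (2 * (\<tau> u)\<^sup>2)"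
        unfolding t2 using \<sigma> p[of u] by (simp add: divide_simps power_mult_distrib) (simp add: algebra_simps)
      have 3: "sqrt (2 * pi * \<sigma>\<^sup>2) = sqrt (2 * pi * (\<tau> u)\<^sup>2) * sqrt (1 + u\<^sup>2)"
        unfolding t2 using p[of u] by (simp add: real_sqrt_mult[symmetric])
      have 4: "exp (- x\<^sup>2 / (2 * \<sigma>\<^sup>2)) * exp (- (x * u)\<^sup>2 / (2 * \<sigma>\<^sup>2)) = exp (- x\<^sup>2 / (2 * (\<tau> u)\<^sup>2))"
        unfolding exp_add[symmetric] 2 ..
      define r where "r = sqrt (2 * pi * \<sigma>\<^sup>2)"
      define r' where "r' = sqrt (2 * pi * (\<tau> u)\<^sup>2)"
      define w where "w = sqrt (1 + u\<^sup>2)"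
      have "r' > 0" "w > 0" using \<tau>[of u] p[of u] by (simp_all add: r'_def w_def)
      moreover have "r = r' * w" using 3 by (simp add: r_def r'_def w_def)
      moreover have "\<bar>x\<bar> * \<bar>x\<bar> = x\<^sup>2" by (simp add: power2_eq_square)
      ultimately have "1 / r * A * (\<bar>x\<bar> * (1 / r * B * (\<bar>x\<bar> * w))) = 1 / r * (1 / r' * (A * B) * x\<^sup>2)" for A B
        by (simp add: field_simps)
      from this[of "exp (- x\<^sup>2 / (2 * \<sigma>\<^sup>2))" "exp (- (x * u)\<^sup>2 / (2 * \<sigma>\<^sup>2))"]
      show ?thesis
        unfolding 4 1 normal_density_def diff_zero r_def[symmetric] r'_def[symmetric] w_def[symmetric] .
    qed
    then show ?thesis
      unfolding * by (simp add: nn_integral_cmult[symmetric] ennreal_mult[symmetric])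
  qed
  have "(\<integral>\<^sup>+x. \<integral>\<^sup>+y. ennreal (sqrt (x\<^sup>2 + y\<^sup>2)) \<partial>gaussian \<sigma> \<partial>gaussian \<sigma>) =
      (\<integral>\<^sup>+x. ennreal (normal_density 0 \<sigma> x) * (\<integral>\<^sup>+y. ennreal (sqrt (x\<^sup>2 + y\<^sup>2)) \<partial>gaussian \<sigma>) \<partial>lborel)"
  proof (rule nn_integral_gaussian)
    interpret N: prob_space "gaussian \<sigma>" using \<sigma> by (rule prob_space_gaussian)
    show "(\<lambda>x. \<integral>\<^sup>+y. ennreal (sqrt (x\<^sup>2 + y\<^sup>2)) \<partial>gaussian \<sigma>) \<in> borel_measurable borel" by measurable
  qed
  also have "\<dots> = (\<integral>\<^sup>+x. \<integral>\<^sup>+u. ennreal (1 / sqrt (2 * pi * \<sigma>\<^sup>2)) * (ennreal (normal_density 0 (\<tau> u) x * x\<^sup>2) * ennreal 1) \<partial>lborel \<partial>lborel)"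
    by (rule nn_integral_cong_AE, rule AE_mp[OF AE_lborel_singleton[of 0]]) (auto simp: sub)
  also have "\<dots> = (\<integral>\<^sup>+u. \<integral>\<^sup>+x. ennreal (1 / sqrt (2 * pi * \<sigma>\<^sup>2)) * (ennreal (normal_density 0 (\<tau> u) x * x\<^sup>2) * ennreal 1) \<partial>lborel \<partial>lborel)"
    by (rule lborel_pair.Fubini') (unfold normal_density_def, measurable)
  also have "\<dots> = (\<integral>\<^sup>+u. ennreal (\<sigma> / sqrt (2 * pi)) * ennreal (1 / (1 + u\<^sup>2)) \<partial>lborel)"
  proof (rule nn_integral_cong)
    fix u :: real
    have "(\<integral>\<^sup>+x. ennreal (1 / sqrt (2 * pi * \<sigma>\<^sup>2)) * (ennreal (normal_density 0 (\<tau> u) x * x\<^sup>2) * ennreal 1) \<partial>lborel) =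
        ennreal (1 / sqrt (2 * pi * \<sigma>\<^sup>2)) * ennreal ((\<tau> u)\<^sup>2)"
      using nn_integral_normal_square[OF \<tau>[of u]] by (simp add: nn_integral_cmult)
    also have "\<dots> = ennreal (\<sigma> / sqrt (2 * pi) * (1 / (1 + u\<^sup>2)))"
      using \<sigma> p[of u] by (simp add: ennreal_mult[symmetric] \<tau>_def power_divide real_sqrt_mult power2_eq_square)
    also have "\<dots> = ennreal (\<sigma> / sqrt (2 * pi)) * ennreal (1 / (1 + u\<^sup>2))"
      using \<sigma> p[of u] by (intro ennreal_mult) auto
    finally show "(\<integral>\<^sup>+x. ennreal (1 / sqrt (2 * pi * \<sigma>\<^sup>2)) * (ennreal (normal_density 0 (\<tau> u) x * x\<^sup>2) * ennreal 1) \<partial>lborel) =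
       ennreal (\<sigma> / sqrt (2 * pi)) * ennreal (1 / (1 + u\<^sup>2))" .
  qed
  also have "\<dots> = ennreal (\<sigma> / sqrt (2 * pi)) * ennreal pi"
    by (subst nn_integral_cmult) (auto simp: nn_integral_inverse_square_plus_1)
  also have "\<dots> = ennreal (\<sigma> * sqrt (pi / 2))"
  proof -
    have "\<sigma> / sqrt (2 * pi) * pi = \<sigma> * sqrt (pi / 2)"
      by (simp add: real_sqrt_mult real_sqrt_divide field_simps)
    then show ?thesis using \<sigma> by (simp add: ennreal_mult[symmetric])
  qed
  finally show ?thesis .
qed

text \<open>For fixed first coordinates the determinant is a linear form in the second ones, with
  mean absolute value \<sigma> sqrt (2/pi) times the norm of the first. The mean of that norm is
  \<sigma> sqrt (pi/2), and the roots cancel.\<close>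

lemma nn_integral_gaussian_det:
  assumes \<sigma>: "0 < \<sigma>"
  shows "(\<integral>\<^sup>+x\<^sub>1. \<integral>\<^sup>+y\<^sub>1. \<integral>\<^sup>+x\<^sub>2. \<integral>\<^sup>+y\<^sub>2. ennreal \<bar>x\<^sub>1 * y\<^sub>2 - y\<^sub>1 * x\<^sub>2\<bar>
    \<partial>gaussian \<sigma> \<partial>gaussian \<sigma> \<partial>gaussian \<sigma> \<partial>gaussian \<sigma>) = ennreal (\<sigma>\<^sup>2)"
proof -
  interpret N: prob_space "gaussian \<sigma>" using \<sigma> by (rule prob_space_gaussian)
  have "(\<integral>\<^sup>+x\<^sub>1. \<integral>\<^sup>+y\<^sub>1. \<integral>\<^sup>+x\<^sub>2. \<integral>\<^sup>+y\<^sub>2. ennreal \<bar>x\<^sub>1 * y\<^sub>2 - y\<^sub>1 * x\<^sub>2\<bar>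
      \<partial>gaussian \<sigma> \<partial>gaussian \<sigma> \<partial>gaussian \<sigma> \<partial>gaussian \<sigma>) =
    (\<integral>\<^sup>+x\<^sub>1. \<integral>\<^sup>+y\<^sub>1. ennreal (\<sigma> * sqrt (2 / pi)) * ennreal (sqrt (x\<^sub>1\<^sup>2 + y\<^sub>1\<^sup>2)) \<partial>gaussian \<sigma> \<partial>gaussian \<sigma>)"
  proof (rule nn_integral_cong_AE, rule AE_mp[OF AE_gaussian_neq[where c = 0]], rule AE_I2, rule impI)
    fix x :: real assume x: "x \<noteq> 0"
    show "(\<integral>\<^sup>+y. \<integral>\<^sup>+x\<^sub>2. \<integral>\<^sup>+y\<^sub>2. ennreal \<bar>x * y\<^sub>2 - y * x\<^sub>2\<bar> \<partial>gaussian \<sigma> \<partial>gaussian \<sigma> \<partial>gaussian \<sigma>) =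
      (\<integral>\<^sup>+y. ennreal (\<sigma> * sqrt (2 / pi)) * ennreal (sqrt (x\<^sup>2 + y\<^sup>2)) \<partial>gaussian \<sigma>)"
    proof (rule nn_integral_cong_AE, rule AE_mp[OF AE_gaussian_neq[where c = 0]], rule AE_I2, rule impI)
      fix y :: real assume "y \<noteq> 0"
      with x show "(\<integral>\<^sup>+x\<^sub>2. \<integral>\<^sup>+y\<^sub>2. ennreal \<bar>x * y\<^sub>2 - y * x\<^sub>2\<bar> \<partial>gaussian \<sigma> \<partial>gaussian \<sigma>) =
        ennreal (\<sigma> * sqrt (2 / pi)) * ennreal (sqrt (x\<^sup>2 + y\<^sup>2))"
        using \<sigma> by (simp add: nn_integral_gaussian_linear_abs ennreal_mult)
    qed
  qed
  also have "\<dots> = ennreal (\<sigma> * sqrt (2 / pi)) * ennreal (\<sigma> * sqrt (pi / 2))"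
    by (simp add: nn_integral_cmult nn_integral_gaussian_norm[OF \<sigma>])
  also have "\<dots> = ennreal (\<sigma>\<^sup>2)"
    using \<sigma> by (simp add: ennreal_mult[symmetric] real_sqrt_mult real_sqrt_divide power2_eq_square)
  finally show ?thesis .
qed

text \<open>Here \<open>1 / h = (1 / \<surd>\<pi>) \<integral> exp (- s\<^sup>2 h\<^sup>2) ds\<close>, after which the tilted Gaussian expectations are explicit.\<close>

lemma nn_integral_gaussian_det_over_norm:
  fixes N defines "N \<equiv> gaussian (sqrt (1 / 2))"
  shows "(\<integral>\<^sup>+x\<^sub>1. \<integral>\<^sup>+y\<^sub>1. \<integral>\<^sup>+x\<^sub>2. \<integral>\<^sup>+y\<^sub>2.
      ennreal (\<bar>x\<^sub>1 * y\<^sub>2 - y\<^sub>1 * x\<^sub>2\<bar> / sqrt (x\<^sub>1\<^sup>2 + y\<^sub>1\<^sup>2 + x\<^sub>2\<^sup>2 + y\<^sub>2\<^sup>2)) \<partial>N \<partial>N \<partial>N \<partial>N) =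
    ennreal (3 * sqrt pi / 16)"
proof -
  interpret N: prob_space N unfolding N_def by (rule prob_space_gaussian) simp
  interpret NL: pair_sigma_finite N lborel ..
  have [measurable_cong]: "sets N = sets borel" by (simp add: N_def)
  \<comment> \<open>The exponential is split by coordinate and nested in the order of integration,
    so each factor leaves the inner integrals and is absorbed into the law of its own
    variable.\<close>
  define F where "F x\<^sub>1 y\<^sub>1 x\<^sub>2 y\<^sub>2 s = ennreal (exp (- (s\<^sup>2 * x\<^sub>1\<^sup>2))) * (ennreal (exp (- (s\<^sup>2 * y\<^sub>1\<^sup>2))) *
    (ennreal (exp (- (s\<^sup>2 * x\<^sub>2\<^sup>2))) * (ennreal (exp (- (s\<^sup>2 * y\<^sub>2\<^sup>2))) * ennreal \<bar>x\<^sub>1 * y\<^sub>2 - y\<^sub>1 * x\<^sub>2\<bar>)))"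
    for x\<^sub>1 y\<^sub>1 x\<^sub>2 y\<^sub>2 s :: real
  have F[measurable]: "(\<lambda>x. F (f1 x) (f2 x) (f3 x) (f4 x) (f5 x)) \<in> borel_measurable K"
    if [measurable]: "f1 \<in> borel_measurable K" "f2 \<in> borel_measurable K" "f3 \<in> borel_measurable K"
      "f4 \<in> borel_measurable K" "f5 \<in> borel_measurable K" for f1 f2 f3 f4 f5 and K :: "'k measure"
    unfolding F_def by measurable
  have F_s: "(\<integral>\<^sup>+s. F x\<^sub>1 y\<^sub>1 x\<^sub>2 y\<^sub>2 s \<partial>lborel) =
      ennreal (sqrt pi) * ennreal (\<bar>x\<^sub>1 * y\<^sub>2 - y\<^sub>1 * x\<^sub>2\<bar> / sqrt (x\<^sub>1\<^sup>2 + y\<^sub>1\<^sup>2 + x\<^sub>2\<^sup>2 + y\<^sub>2\<^sup>2))"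
    if "x\<^sub>1 \<noteq> 0" for x\<^sub>1 y\<^sub>1 x\<^sub>2 y\<^sub>2
  proof -
    define h where "h = sqrt (x\<^sub>1\<^sup>2 + y\<^sub>1\<^sup>2 + x\<^sub>2\<^sup>2 + y\<^sub>2\<^sup>2)"
    have h: "h > 0" "h\<^sup>2 = x\<^sub>1\<^sup>2 + y\<^sub>1\<^sup>2 + x\<^sub>2\<^sup>2 + y\<^sub>2\<^sup>2"
      using that by (auto simp: h_def add_pos_nonneg)
    have "F x\<^sub>1 y\<^sub>1 x\<^sub>2 y\<^sub>2 s = ennreal (exp (- (s\<^sup>2 * h\<^sup>2))) * ennreal \<bar>x\<^sub>1 * y\<^sub>2 - y\<^sub>1 * x\<^sub>2\<bar>" for s
    proof -
      have "exp (- (s\<^sup>2 * h\<^sup>2)) = exp (- (s\<^sup>2 * x\<^sub>1\<^sup>2)) * (exp (- (s\<^sup>2 * y\<^sub>1\<^sup>2)) * (exp (- (s\<^sup>2 * x\<^sub>2\<^sup>2)) * exp (- (s\<^sup>2 * y\<^sub>2\<^sup>2))))"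
        unfolding h exp_add[symmetric] by (simp add: algebra_simps)
      then show ?thesis unfolding F_def by (simp add: ennreal_mult mult_ac)
    qed
    then have "(\<integral>\<^sup>+s. F x\<^sub>1 y\<^sub>1 x\<^sub>2 y\<^sub>2 s \<partial>lborel) = ennreal (sqrt pi / h) * ennreal \<bar>x\<^sub>1 * y\<^sub>2 - y\<^sub>1 * x\<^sub>2\<bar>"
      by (simp add: nn_integral_multc nn_integral_exp_square[OF h(1)])
    also have "\<dots> = ennreal (sqrt pi) * ennreal (\<bar>x\<^sub>1 * y\<^sub>2 - y\<^sub>1 * x\<^sub>2\<bar> / h)"
      using h(1) by (simp add: ennreal_mult[symmetric])
    finally show ?thesis unfolding h_def .
  qed
  have F_x: "(\<integral>\<^sup>+x\<^sub>1. \<integral>\<^sup>+y\<^sub>1. \<integral>\<^sup>+x\<^sub>2. \<integral>\<^sup>+y\<^sub>2. F x\<^sub>1 y\<^sub>1 x\<^sub>2 y\<^sub>2 s \<partial>N \<partial>N \<partial>N \<partial>N) =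
      ennreal (1 / 2) * ennreal (1 / (1 + s\<^sup>2) ^ 3)" for s
  proof -
    define \<sigma> where "\<sigma> = sqrt (1 / (2 * (1 + s\<^sup>2)))"
    have p: "1 + s\<^sup>2 > 0" by (simp add: add_pos_nonneg)
    have \<sigma>: "\<sigma> > 0" "\<sigma>\<^sup>2 = 1 / (2 * (1 + s\<^sup>2))" using p by (simp_all add: \<sigma>_def)
    interpret G: prob_space "gaussian \<sigma>" using \<sigma>(1) by (rule prob_space_gaussian)
    define c where "c = ennreal (1 / sqrt (1 + s\<^sup>2))"
    have tilt: "(\<integral>\<^sup>+x. ennreal (exp (- (s\<^sup>2 * x\<^sup>2))) * f x \<partial>N) = c * (\<integral>\<^sup>+x. f x \<partial>gaussian \<sigma>)"
      if "f \<in> borel_measurable borel" for f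
      unfolding N_def c_def \<sigma>_def using that by (rule nn_integral_gaussian_tilt)
    have "(\<integral>\<^sup>+x\<^sub>1. \<integral>\<^sup>+y\<^sub>1. \<integral>\<^sup>+x\<^sub>2. \<integral>\<^sup>+y\<^sub>2. F x\<^sub>1 y\<^sub>1 x\<^sub>2 y\<^sub>2 s \<partial>N \<partial>N \<partial>N \<partial>N) = c * (c * (c * (c *
      (\<integral>\<^sup>+x\<^sub>1. \<integral>\<^sup>+y\<^sub>1. \<integral>\<^sup>+x\<^sub>2. \<integral>\<^sup>+y\<^sub>2. ennreal \<bar>x\<^sub>1 * y\<^sub>2 - y\<^sub>1 * x\<^sub>2\<bar>
        \<partial>gaussian \<sigma> \<partial>gaussian \<sigma> \<partial>gaussian \<sigma> \<partial>gaussian \<sigma>))))"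
      unfolding F_def by (simp add: nn_integral_cmult tilt)
    \<comment> \<open>The four tilts give (1 + s^2)^(-2) and the determinant gives the reduced
      variance 1 / (2 (1 + s^2)), whence the cube.\<close>
    also have "\<dots> = ennreal (1 / sqrt (1 + s\<^sup>2) * (1 / sqrt (1 + s\<^sup>2) * (1 / sqrt (1 + s\<^sup>2) * (1 / sqrt (1 + s\<^sup>2) * \<sigma>\<^sup>2))))"
      unfolding c_def nn_integral_gaussian_det[OF \<sigma>(1)] using p by (simp add: ennreal_mult[symmetric])
    also have "1 / sqrt (1 + s\<^sup>2) * (1 / sqrt (1 + s\<^sup>2) * (1 / sqrt (1 + s\<^sup>2) * (1 / sqrt (1 + s\<^sup>2) * \<sigma>\<^sup>2))) =
        1 / (sqrt (1 + s\<^sup>2))\<^sup>2 * (1 / (sqrt (1 + s\<^sup>2))\<^sup>2 * \<sigma>\<^sup>2)"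
      by (simp add: power2_eq_square)
    also have "\<dots> = 1 / 2 * (1 / (1 + s\<^sup>2) ^ 3)"
      unfolding \<sigma>(2) using p by (simp add: power3_eq_cube)
    also have "ennreal (1 / 2 * (1 / (1 + s\<^sup>2) ^ 3)) = ennreal (1 / 2) * ennreal (1 / (1 + s\<^sup>2) ^ 3)"
      using p by (intro ennreal_mult) auto
    finally show ?thesis .
  qed
  \<comment> \<open>Used four times to carry the integral over \<open>s\<close> outward past one
    Gaussian variable at a time.\<close>
  have swap: "(\<integral>\<^sup>+x. \<integral>\<^sup>+s. f x s \<partial>lborel \<partial>N) = (\<integral>\<^sup>+s. \<integral>\<^sup>+x. f x s \<partial>N \<partial>lborel)"
    if "case_prod f \<in> borel_measurable (N \<Otimes>\<^sub>M lborel)" for f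
    using NL.Fubini'[OF that] ..
  let ?I = "\<integral>\<^sup>+x\<^sub>1. \<integral>\<^sup>+y\<^sub>1. \<integral>\<^sup>+x\<^sub>2. \<integral>\<^sup>+y\<^sub>2.
      ennreal (\<bar>x\<^sub>1 * y\<^sub>2 - y\<^sub>1 * x\<^sub>2\<bar> / sqrt (x\<^sub>1\<^sup>2 + y\<^sub>1\<^sup>2 + x\<^sub>2\<^sup>2 + y\<^sub>2\<^sup>2)) \<partial>N \<partial>N \<partial>N \<partial>N"
  have "ennreal (sqrt pi) * ?I = (\<integral>\<^sup>+x\<^sub>1. \<integral>\<^sup>+y\<^sub>1. \<integral>\<^sup>+x\<^sub>2. \<integral>\<^sup>+y\<^sub>2. \<integral>\<^sup>+s. F x\<^sub>1 y\<^sub>1 x\<^sub>2 y\<^sub>2 s \<partial>lborel \<partial>N \<partial>N \<partial>N \<partial>N)"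
  proof -
    have "AE x in N. x \<noteq> 0" unfolding N_def by (rule AE_gaussian_neq)
    then have "(\<integral>\<^sup>+x\<^sub>1. \<integral>\<^sup>+y\<^sub>1. \<integral>\<^sup>+x\<^sub>2. \<integral>\<^sup>+y\<^sub>2. \<integral>\<^sup>+s. F x\<^sub>1 y\<^sub>1 x\<^sub>2 y\<^sub>2 s \<partial>lborel \<partial>N \<partial>N \<partial>N \<partial>N) =
      (\<integral>\<^sup>+x\<^sub>1. \<integral>\<^sup>+y\<^sub>1. \<integral>\<^sup>+x\<^sub>2. \<integral>\<^sup>+y\<^sub>2. ennreal (sqrt pi) *
      ennreal (\<bar>x\<^sub>1 * y\<^sub>2 - y\<^sub>1 * x\<^sub>2\<bar> / sqrt (x\<^sub>1\<^sup>2 + y\<^sub>1\<^sup>2 + x\<^sub>2\<^sup>2 + y\<^sub>2\<^sup>2)) \<partial>N \<partial>N \<partial>N \<partial>N)"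
      by (intro nn_integral_cong_AE) (auto simp: F_s)
    then show ?thesis by (simp add: nn_integral_cmult)
  qed
  also have "\<dots> = (\<integral>\<^sup>+x\<^sub>1. \<integral>\<^sup>+y\<^sub>1. \<integral>\<^sup>+x\<^sub>2. \<integral>\<^sup>+s. \<integral>\<^sup>+y\<^sub>2. F x\<^sub>1 y\<^sub>1 x\<^sub>2 y\<^sub>2 s \<partial>N \<partial>lborel \<partial>N \<partial>N \<partial>N)"
    by (intro nn_integral_cong swap) measurable
  also have "\<dots> = (\<integral>\<^sup>+x\<^sub>1. \<integral>\<^sup>+y\<^sub>1. \<integral>\<^sup>+s. \<integral>\<^sup>+x\<^sub>2. \<integral>\<^sup>+y\<^sub>2. F x\<^sub>1 y\<^sub>1 x\<^sub>2 y\<^sub>2 s \<partial>N \<partial>N \<partial>lborel \<partial>N \<partial>N)"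
    by (intro nn_integral_cong swap) measurable
  also have "\<dots> = (\<integral>\<^sup>+x\<^sub>1. \<integral>\<^sup>+s. \<integral>\<^sup>+y\<^sub>1. \<integral>\<^sup>+x\<^sub>2. \<integral>\<^sup>+y\<^sub>2. F x\<^sub>1 y\<^sub>1 x\<^sub>2 y\<^sub>2 s \<partial>N \<partial>N \<partial>N \<partial>lborel \<partial>N)"
    by (intro nn_integral_cong swap) measurable
  also have "\<dots> = (\<integral>\<^sup>+s. \<integral>\<^sup>+x\<^sub>1. \<integral>\<^sup>+y\<^sub>1. \<integral>\<^sup>+x\<^sub>2. \<integral>\<^sup>+y\<^sub>2. F x\<^sub>1 y\<^sub>1 x\<^sub>2 y\<^sub>2 s \<partial>N \<partial>N \<partial>N \<partial>N \<partial>lborel)"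
    by (rule swap) measurable
  also have "\<dots> = ennreal (1 / 2) * ennreal (3 * pi / 8)"
    unfolding F_x by (subst nn_integral_cmult) (auto simp: nn_integral_inverse_cube_square_plus_1)
  also have "\<dots> = ennreal (1 / 2 * (3 * pi / 8))"
    by (rule ennreal_mult[symmetric]) auto
  also have "1 / 2 * (3 * pi / 8) = sqrt pi * (3 * sqrt pi / 16)" by simp
  also have "ennreal \<dots> = ennreal (sqrt pi) * ennreal (3 * sqrt pi / 16)"
    by (rule ennreal_mult) auto
  finally show ?thesis
    by (subst (asm) ennreal_mult_cancel_left) auto
qed

section \<open>The triangle spanned at times 0, 1/2 and 1\<close>

text \<open>
  The inradius of the triangle \<open>0, X, X + Y\<close> for \<open>X = (x\<^sub>1, x\<^sub>2)\<close> and \<open>Y = (y\<^sub>1, y\<^sub>2)\<close>; arguments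
  are grouped by coordinate because the coordinate processes are what is independent.
\<close>

definition incircle_radius :: "real \<Rightarrow> real \<Rightarrow> real \<Rightarrow> real \<Rightarrow> real" where
  "incircle_radius x\<^sub>1 y\<^sub>1 x\<^sub>2 y\<^sub>2 = \<bar>x\<^sub>1 * y\<^sub>2 - y\<^sub>1 * x\<^sub>2\<bar> /
    (sqrt (x\<^sub>1\<^sup>2 + x\<^sub>2\<^sup>2) + sqrt (y\<^sub>1\<^sup>2 + y\<^sub>2\<^sup>2) + sqrt ((x\<^sub>1 + y\<^sub>1)\<^sup>2 + (x\<^sub>2 + y\<^sub>2)\<^sup>2))"

lemma incircle_radius_nonneg: "0 \<le> incircle_radius x\<^sub>1 y\<^sub>1 x\<^sub>2 y\<^sub>2"
  by (simp add: incircle_radius_def)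

lemma borel_measurable_incircle_radius [measurable (raw)]:
  assumes [measurable]: "f1 \<in> borel_measurable K" "f2 \<in> borel_measurable K"
    "f3 \<in> borel_measurable K" "f4 \<in> borel_measurable K"
  shows "(\<lambda>x. incircle_radius (f1 x) (f2 x) (f3 x) (f4 x)) \<in> borel_measurable K"
  unfolding incircle_radius_def by measurable

lemma add_le_sqrt_double:
  fixes a b :: real
  shows "a + b \<le> sqrt (2 * (a\<^sup>2 + b\<^sup>2))"
proof (rule real_le_rsqrt)
  have "0 \<le> (a - b)\<^sup>2" by simp
  then show "(a + b)\<^sup>2 \<le> 2 * (a\<^sup>2 + b\<^sup>2)" by (simp add: power2_sum power2_diff)
qed

text \<open>
  Reflecting \<open>Y\<close> exchanges \<open>X + Y\<close> and \<open>X - Y\<close>, whose lengths average to at most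
  \<open>h = \<surd>(\<bar>X\<bar>\<^sup>2 + \<bar>Y\<bar>\<^sup>2)\<close> by the parallelogram law.
\<close>

lemma incircle_radius_symmetrized:
  defines "h x\<^sub>1 y\<^sub>1 x\<^sub>2 y\<^sub>2 \<equiv> sqrt (x\<^sub>1\<^sup>2 + y\<^sub>1\<^sup>2 + x\<^sub>2\<^sup>2 + y\<^sub>2\<^sup>2)"
  shows "2 / (1 + sqrt 2) * (\<bar>x\<^sub>1 * y\<^sub>2 - y\<^sub>1 * x\<^sub>2\<bar> / h x\<^sub>1 y\<^sub>1 x\<^sub>2 y\<^sub>2) \<le>
    incircle_radius x\<^sub>1 y\<^sub>1 x\<^sub>2 y\<^sub>2 + incircle_radius x\<^sub>1 (- y\<^sub>1) x\<^sub>2 (- y\<^sub>2)"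
proof (cases "x\<^sub>1 * y\<^sub>2 - y\<^sub>1 * x\<^sub>2 = 0")
  case True
  then show ?thesis by (simp add: incircle_radius_nonneg)
next
  case False
  define d where "d = \<bar>x\<^sub>1 * y\<^sub>2 - y\<^sub>1 * x\<^sub>2\<bar>"
  define a b where "a = sqrt (x\<^sub>1\<^sup>2 + x\<^sub>2\<^sup>2)" and "b = sqrt (y\<^sub>1\<^sup>2 + y\<^sub>2\<^sup>2)"
  define c c' where "c = sqrt ((x\<^sub>1 + y\<^sub>1)\<^sup>2 + (x\<^sub>2 + y\<^sub>2)\<^sup>2)" and "c' = sqrt ((x\<^sub>1 - y\<^sub>1)\<^sup>2 + (x\<^sub>2 - y\<^sub>2)\<^sup>2)"
  define r where "r = sqrt (x\<^sub>1\<^sup>2 + y\<^sub>1\<^sup>2 + x\<^sub>2\<^sup>2 + y\<^sub>2\<^sup>2)"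
  have d: "d > 0" using False by (simp add: d_def)
  have "x\<^sub>1 \<noteq> 0 \<or> x\<^sub>2 \<noteq> 0" using False by auto
  then have "x\<^sub>1\<^sup>2 + x\<^sub>2\<^sup>2 > 0" by (auto simp: sum_power2_gt_zero_iff)
  moreover have "x\<^sub>1\<^sup>2 + x\<^sub>2\<^sup>2 \<le> x\<^sub>1\<^sup>2 + y\<^sub>1\<^sup>2 + x\<^sub>2\<^sup>2 + y\<^sub>2\<^sup>2" by simp
  ultimately have a: "a > 0" and r: "r > 0"
    unfolding a_def r_def real_sqrt_gt_0_iff by linarith+
  have nn: "b \<ge> 0" "c \<ge> 0" "c' \<ge> 0" by (simp_all add: b_def c_def c'_def)
  have r2: "r\<^sup>2 = x\<^sub>1\<^sup>2 + y\<^sub>1\<^sup>2 + x\<^sub>2\<^sup>2 + y\<^sub>2\<^sup>2" by (simp add: r_def)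
  have "a\<^sup>2 + b\<^sup>2 = r\<^sup>2" unfolding r2 by (simp add: a_def b_def)
  then have "a + b \<le> sqrt 2 * r"
    using add_le_sqrt_double[of a b] r by (simp add: real_sqrt_mult)
  moreover have "c\<^sup>2 + c'\<^sup>2 = 2 * r\<^sup>2"
    unfolding r2 c_def c'_def
    by (simp only: real_sqrt_pow2 sum_power2_ge_zero) (simp add: power2_sum power2_diff)
  then have "c + c' \<le> 2 * r"
    using add_le_sqrt_double[of c c'] r by (simp add: real_sqrt_mult)
  ultimately have le: "(a + b + c) + (a + b + c') \<le> 2 * (1 + sqrt 2) * r"
    by (simp add: algebra_simps)
  define p q where "p = a + b + c" and "q = a + b + c'"
  have pq: "p > 0" "q > 0" using a nn by (auto simp: p_def q_def)
  have "2 / k * (d / r) = 4 * d / (2 * k * r)" for k by simp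
  then have "2 / (1 + sqrt 2) * (d / r) = 4 * d / (2 * (1 + sqrt 2) * r)" .
  also have "\<dots> \<le> 4 * d / (p + q)"
    using le d pq by (intro divide_left_mono) (auto simp: p_def q_def add_pos_pos r)
  \<comment> \<open>Convexity of the reciprocal, as the inequality between the harmonic and
    arithmetic means of \<open>p\<close> and \<open>q\<close>.\<close>
  also have "\<dots> \<le> d / p + d / q"
  proof -
    have "4 * (p * q) \<le> (p + q) * (p + q)"
      using zero_le_power2[of "p - q"] by (simp add: power2_eq_square algebra_simps)
    then have "d * (4 * (p * q)) \<le> d * ((p + q) * (p + q))" using d by (intro mult_left_mono) auto
    then show ?thesis using pq by (simp add: divide_simps add_pos_pos) (simp add: algebra_simps)
  qed
  also have "\<dots> = incircle_radius x\<^sub>1 y\<^sub>1 x\<^sub>2 y\<^sub>2 + incircle_radius x\<^sub>1 (- y\<^sub>1) x\<^sub>2 (- y\<^sub>2)"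
  proof -
    have "\<bar>y\<^sub>1 * x\<^sub>2 - x\<^sub>1 * y\<^sub>2\<bar> = d" by (simp add: d_def abs_minus_commute)
    then show ?thesis
      unfolding incircle_radius_def p_def q_def a_def b_def c_def c'_def d_def by simp
  qed
  finally show ?thesis unfolding d_def r_def h_def .
qed

text \<open>Both terms of the symmetrized bound have the same integral because the product law is
  invariant under the reflection, so that bound integrates to half of itself for each term.\<close>

lemma nn_integral_gaussian_incircle_radius_ge:
  fixes N defines "N \<equiv> gaussian (sqrt (1 / 2))"
  shows "ennreal (sqrt pi / (8 + 4 * sqrt 2)) \<le>
    (\<integral>\<^sup>+x\<^sub>1. \<integral>\<^sup>+y\<^sub>1. \<integral>\<^sup>+x\<^sub>2. \<integral>\<^sup>+y\<^sub>2. ennreal (incircle_radius x\<^sub>1 y\<^sub>1 x\<^sub>2 y\<^sub>2) \<partial>N \<partial>N \<partial>N \<partial>N)"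
    (is "_ \<le> ?I")
proof -
  interpret N: prob_space N unfolding N_def by (rule prob_space_gaussian) simp
  have sets_N [measurable_cong]: "sets N = sets borel" by (simp add: N_def)
  have mirror: "(\<integral>\<^sup>+x. f (- x) \<partial>N) = (\<integral>\<^sup>+x. f x \<partial>N)" if "f \<in> borel_measurable borel" for f
    unfolding N_def using that by (rule nn_integral_gaussian_uminus)
  \<comment> \<open>The signs are removed from the inside out, first for the innermost variable with
    the others fixed, then for the outer one.\<close>
  have I': "(\<integral>\<^sup>+x\<^sub>1. \<integral>\<^sup>+y\<^sub>1. \<integral>\<^sup>+x\<^sub>2. \<integral>\<^sup>+y\<^sub>2. ennreal (incircle_radius x\<^sub>1 (- y\<^sub>1) x\<^sub>2 (- y\<^sub>2)) \<partial>N \<partial>N \<partial>N \<partial>N) = ?I"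
  proof (rule nn_integral_cong)
    fix x\<^sub>1
    have "(\<integral>\<^sup>+y\<^sub>1. \<integral>\<^sup>+x\<^sub>2. \<integral>\<^sup>+y\<^sub>2. ennreal (incircle_radius x\<^sub>1 (- y\<^sub>1) x\<^sub>2 (- y\<^sub>2)) \<partial>N \<partial>N \<partial>N) =
      (\<integral>\<^sup>+y\<^sub>1. \<integral>\<^sup>+x\<^sub>2. \<integral>\<^sup>+y\<^sub>2. ennreal (incircle_radius x\<^sub>1 (- y\<^sub>1) x\<^sub>2 y\<^sub>2) \<partial>N \<partial>N \<partial>N)"
      by (intro nn_integral_cong mirror) measurable
    also have "\<dots> = (\<integral>\<^sup>+y\<^sub>1. \<integral>\<^sup>+x\<^sub>2. \<integral>\<^sup>+y\<^sub>2. ennreal (incircle_radius x\<^sub>1 y\<^sub>1 x\<^sub>2 y\<^sub>2) \<partial>N \<partial>N \<partial>N)"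
      by (rule mirror) measurable
    finally show "(\<integral>\<^sup>+y\<^sub>1. \<integral>\<^sup>+x\<^sub>2. \<integral>\<^sup>+y\<^sub>2. ennreal (incircle_radius x\<^sub>1 (- y\<^sub>1) x\<^sub>2 (- y\<^sub>2)) \<partial>N \<partial>N \<partial>N) = \<dots>" .
  qed
  have "2 * ennreal (sqrt pi / (8 + 4 * sqrt 2)) \<le> ennreal (2 / (1 + sqrt 2)) * ennreal (3 * sqrt pi / 16)"
  proof -
    \<comment> \<open>With denominators cleared, the comparison of constants reads 16 (1 + sqrt 2)
      \<le> 3 (8 + 4 sqrt 2), which is equivalent to this.\<close>
    have "sqrt 2 \<le> 2" by (rule real_le_lsqrt) auto
    then have "1 / (8 + 4 * sqrt 2) \<le> 1 / (1 + sqrt 2) * (3 / 16)"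
      by (simp add: divide_simps add_pos_pos)
    from mult_left_mono[OF this, of "2 * sqrt pi"]
    have "2 * (sqrt pi / (8 + 4 * sqrt 2)) \<le> 2 / (1 + sqrt 2) * (3 * sqrt pi / 16)" by simp
    then have "ennreal (2 * (sqrt pi / (8 + 4 * sqrt 2))) \<le> ennreal (2 / (1 + sqrt 2) * (3 * sqrt pi / 16))"
      by (rule ennreal_leI)
    moreover have "ennreal (2 * (sqrt pi / (8 + 4 * sqrt 2))) = 2 * ennreal (sqrt pi / (8 + 4 * sqrt 2))"
      by (subst ennreal_mult) auto
    moreover have "ennreal (2 / (1 + sqrt 2) * (3 * sqrt pi / 16)) = ennreal (2 / (1 + sqrt 2)) * ennreal (3 * sqrt pi / 16)"
      by (rule ennreal_mult) auto
    ultimately show ?thesis by (simp only:)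
  qed
  also have "\<dots> = (\<integral>\<^sup>+x\<^sub>1. \<integral>\<^sup>+y\<^sub>1. \<integral>\<^sup>+x\<^sub>2. \<integral>\<^sup>+y\<^sub>2. ennreal (2 / (1 + sqrt 2)) *
      ennreal (\<bar>x\<^sub>1 * y\<^sub>2 - y\<^sub>1 * x\<^sub>2\<bar> / sqrt (x\<^sub>1\<^sup>2 + y\<^sub>1\<^sup>2 + x\<^sub>2\<^sup>2 + y\<^sub>2\<^sup>2)) \<partial>N \<partial>N \<partial>N \<partial>N)"
    using nn_integral_gaussian_det_over_norm by (simp add: N_def[symmetric] nn_integral_cmult)
  also have "\<dots> \<le> (\<integral>\<^sup>+x\<^sub>1. \<integral>\<^sup>+y\<^sub>1. \<integral>\<^sup>+x\<^sub>2. \<integral>\<^sup>+y\<^sub>2. ennreal (incircle_radius x\<^sub>1 y\<^sub>1 x\<^sub>2 y\<^sub>2) +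
      ennreal (incircle_radius x\<^sub>1 (- y\<^sub>1) x\<^sub>2 (- y\<^sub>2)) \<partial>N \<partial>N \<partial>N \<partial>N)"
  proof (intro nn_integral_mono)
    fix x\<^sub>1 y\<^sub>1 x\<^sub>2 y\<^sub>2 :: real
    show "ennreal (2 / (1 + sqrt 2)) * ennreal (\<bar>x\<^sub>1 * y\<^sub>2 - y\<^sub>1 * x\<^sub>2\<bar> / sqrt (x\<^sub>1\<^sup>2 + y\<^sub>1\<^sup>2 + x\<^sub>2\<^sup>2 + y\<^sub>2\<^sup>2)) \<le>
      ennreal (incircle_radius x\<^sub>1 y\<^sub>1 x\<^sub>2 y\<^sub>2) + ennreal (incircle_radius x\<^sub>1 (- y\<^sub>1) x\<^sub>2 (- y\<^sub>2))"
      using ennreal_leI[OF incircle_radius_symmetrized]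
      by (subst ennreal_mult[symmetric])
        (auto simp del: times_divide_eq_left times_divide_eq_right times_divide_times_eq
          simp flip: ennreal_plus simp: incircle_radius_nonneg)
  qed
  also have "\<dots> = ?I + ?I"
    by (simp add: nn_integral_add I')
  also have "\<dots> = 2 * ?I" by (simp add: mult_2)
  finally show ?thesis
    by (simp add: ennreal_mult_le_mult_iff)
qed

section \<open>The joint law of the two half-time increments\<close>

lemma (in standard_brownian_motion) distr_half_increments:
  "distr M (borel \<Otimes>\<^sub>M borel) (\<lambda>\<omega>. (B (1 / 2) \<omega> - B 0 \<omega>, B 1 \<omega> - B (1 / 2) \<omega>)) =
    gaussian (sqrt (1 / 2)) \<Otimes>\<^sub>M gaussian (sqrt (1 / 2))"
proof -
  define u :: "nat \<Rightarrow> real" where "u i = real i / 2" for i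
  have "indep_vars (\<lambda>_. borel) (\<lambda>i \<omega>. B (u (Suc i)) \<omega> - B (u i) \<omega>) {..<2}"
    by (rule independent_increments) (auto simp: u_def)
  \<comment> \<open>Independence is taken for two singleton blocks of indices; evaluation then
    recovers the two increments.\<close>
  from indep_var_restrict[OF this, of "{0}" "{1}"]
  have "indep_var (\<Pi>\<^sub>M i\<in>{0}. borel) (\<lambda>\<omega>. \<lambda>i\<in>{0}. B (u (Suc i)) \<omega> - B (u i) \<omega>)
      (\<Pi>\<^sub>M i\<in>{1}. borel) (\<lambda>\<omega>. \<lambda>i\<in>{1}. B (u (Suc i)) \<omega> - B (u i) \<omega>)"
    by auto
  from indep_var_compose[OF this, of "\<lambda>f. f 0" borel "\<lambda>f. f 1" borel]
  have "indep_var borel (\<lambda>\<omega>. B (1 / 2) \<omega> - B 0 \<omega>) borel (\<lambda>\<omega>. B 1 \<omega> - B (1 / 2) \<omega>)"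
    by (simp add: comp_def u_def)
  moreover have "distr M borel (\<lambda>\<omega>. B (1 / 2) \<omega> - B 0 \<omega>) = gaussian (sqrt (1 / 2))"
    using gaussian_increments[of 0 "1 / 2"] by (simp add: distributed_gaussian_iff)
  moreover have "distr M borel (\<lambda>\<omega>. B 1 \<omega> - B (1 / 2) \<omega>) = gaussian (sqrt (1 / 2))"
    using gaussian_increments[of "1 / 2" 1] by (simp add: distributed_gaussian_iff)
  ultimately show ?thesis unfolding indep_var_distribution_eq by simp
qed

text \<open>Each coordinate contributes a product law over its two time intervals, and independence
  of the coordinate processes multiplies the two laws; Tonelli unfolds the result.\<close>

lemma (in planar_brownian_motion) nn_integral_half_increments:
  fixes f :: "real \<Rightarrow> real \<Rightarrow> real \<Rightarrow> real \<Rightarrow> ennreal"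
  defines "N \<equiv> gaussian (sqrt (1 / 2))"
  assumes f [measurable]: "(\<lambda>((x\<^sub>1, y\<^sub>1), (x\<^sub>2, y\<^sub>2)). f x\<^sub>1 y\<^sub>1 x\<^sub>2 y\<^sub>2) \<in>
    borel_measurable ((borel \<Otimes>\<^sub>M borel) \<Otimes>\<^sub>M (borel \<Otimes>\<^sub>M borel))"
  shows "(\<integral>\<^sup>+\<omega>. f ((W (1 / 2) \<omega> - W 0 \<omega>) $ 1) ((W 1 \<omega> - W (1 / 2) \<omega>) $ 1)
      ((W (1 / 2) \<omega> - W 0 \<omega>) $ 2) ((W 1 \<omega> - W (1 / 2) \<omega>) $ 2) \<partial>M) =
    (\<integral>\<^sup>+x\<^sub>1. \<integral>\<^sup>+y\<^sub>1. \<integral>\<^sup>+x\<^sub>2. \<integral>\<^sup>+y\<^sub>2. f x\<^sub>1 y\<^sub>1 x\<^sub>2 y\<^sub>2 \<partial>N \<partial>N \<partial>N \<partial>N)"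
proof -
  interpret N: prob_space N unfolding N_def by (rule prob_space_gaussian) simp
  interpret NN: pair_prob_space N N ..
  have sets_N [measurable_cong]: "sets N = sets borel" by (simp add: N_def)
  define P where "P i \<omega> = (W (1 / 2) \<omega> $ i - W 0 \<omega> $ i, W 1 \<omega> $ i - W (1 / 2) \<omega> $ i)" for i \<omega>
  \<comment> \<open>Only three times of the index set are read, so \<open>inc\<close> is measurable
    on the product space and independence of the processes passes to the pairs of
    increments.\<close>
  define inc where "inc g = (g (1 / 2) - g 0, g 1 - g (1 / 2))" for g :: "real \<Rightarrow> real"
  have inc: "inc \<in> (\<Pi>\<^sub>M t\<in>{0..}. borel) \<rightarrow>\<^sub>M borel \<Otimes>\<^sub>M borel"
    unfolding inc_def by measurable
  have distr_P: "distr M (borel \<Otimes>\<^sub>M borel) (P i) = N \<Otimes>\<^sub>M N" for i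
    unfolding P_def N_def
    by (rule standard_brownian_motion.distr_half_increments[OF coordinate_brownian])
  have "indep_var (borel \<Otimes>\<^sub>M borel) (P 1) (borel \<Otimes>\<^sub>M borel) (P 2)"
    using indep_var_compose[OF independent_coordinates inc inc]
    by (simp add: comp_def inc_def P_def[abs_def])
  then have rv [measurable]: "P 1 \<in> M \<rightarrow>\<^sub>M borel \<Otimes>\<^sub>M borel" "P 2 \<in> M \<rightarrow>\<^sub>M borel \<Otimes>\<^sub>M borel"
    and law: "distr M ((borel \<Otimes>\<^sub>M borel) \<Otimes>\<^sub>M (borel \<Otimes>\<^sub>M borel)) (\<lambda>\<omega>. (P 1 \<omega>, P 2 \<omega>)) = (N \<Otimes>\<^sub>M N) \<Otimes>\<^sub>M (N \<Otimes>\<^sub>M N)"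
    unfolding indep_var_distribution_eq distr_P by auto
  let ?g = "\<lambda>((x\<^sub>1, y\<^sub>1), (x\<^sub>2, y\<^sub>2)). f x\<^sub>1 y\<^sub>1 x\<^sub>2 y\<^sub>2"
  have "(\<integral>\<^sup>+\<omega>. f ((W (1 / 2) \<omega> - W 0 \<omega>) $ 1) ((W 1 \<omega> - W (1 / 2) \<omega>) $ 1)
      ((W (1 / 2) \<omega> - W 0 \<omega>) $ 2) ((W 1 \<omega> - W (1 / 2) \<omega>) $ 2) \<partial>M) = (\<integral>\<^sup>+\<omega>. ?g (P 1 \<omega>, P 2 \<omega>) \<partial>M)"
    by (simp add: P_def)
  also have "\<dots> = (\<integral>\<^sup>+p. ?g p \<partial>((N \<Otimes>\<^sub>M N) \<Otimes>\<^sub>M (N \<Otimes>\<^sub>M N)))"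
    unfolding law[symmetric] by (rule nn_integral_distr[symmetric]) auto
  also have "\<dots> = (\<integral>\<^sup>+p. \<integral>\<^sup>+q. ?g (p, q) \<partial>(N \<Otimes>\<^sub>M N) \<partial>(N \<Otimes>\<^sub>M N))"
    by (rule NN.nn_integral_fst[symmetric]) measurable
  also have "\<dots> = (\<integral>\<^sup>+x\<^sub>1. \<integral>\<^sup>+y\<^sub>1. \<integral>\<^sup>+q. ?g ((x\<^sub>1, y\<^sub>1), q) \<partial>(N \<Otimes>\<^sub>M N) \<partial>N \<partial>N)"
    by (rule N.nn_integral_fst[symmetric]) measurable
  also have "\<dots> = (\<integral>\<^sup>+x\<^sub>1. \<integral>\<^sup>+y\<^sub>1. \<integral>\<^sup>+x\<^sub>2. \<integral>\<^sup>+y\<^sub>2. ?g ((x\<^sub>1, y\<^sub>1), (x\<^sub>2, y\<^sub>2)) \<partial>N \<partial>N \<partial>N \<partial>N)"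
    by (intro nn_integral_cong N.nn_integral_fst[symmetric]) measurable
  finally show ?thesis by simp
qed

section \<open>Convex hulls of planar Brownian paths\<close>

context planar_brownian_motion
begin

lemma continuous_on_path: "\<omega> \<in> space M \<Longrightarrow> continuous_on {0..1} (\<lambda>t. W t \<omega>)"
proof -
  assume \<omega>: "\<omega> \<in> space M"
  have "continuous_on {0..1} (\<lambda>t. W t \<omega> $ i)" for i
    using standard_brownian_motion.continuous_paths[OF coordinate_brownian \<omega>]
    by (rule continuous_on_subset) auto
  then have "continuous_on {0..1} (\<lambda>t. \<chi> i. W t \<omega> $ i)" by (rule continuous_on_vec_lambda)
  then show ?thesis by simp
qed

lemma borel_measurable_at: "0 \<le> t \<Longrightarrow> W t \<in> borel_measurable M"
proof (subst borel_measurable_euclidean_space, rule ballI)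
  fix e :: "real ^ 2" assume "0 \<le> t" "e \<in> Basis"
  then obtain i where "e = axis i 1" by (auto simp: Basis_vec_def)
  then show "(\<lambda>\<omega>. W t \<omega> \<bullet> e) \<in> borel_measurable M"
    using standard_brownian_motion.measurable_at[OF coordinate_brownian \<open>0 \<le> t\<close>, of i]
    by (simp add: inner_axis)
qed

abbreviation "path_hull \<omega> \<equiv> convex hull ((\<lambda>s. W s \<omega>) ` {0..1})"

lemma bounded_path_hull: "\<omega> \<in> space M \<Longrightarrow> bounded (path_hull \<omega>)"
  by (intro compact_imp_bounded compact_convex_hull compact_continuous_image continuous_on_path) auto

lemma inradius_path_hull_nonneg: "\<omega> \<in> space M \<Longrightarrow> 0 \<le> inradius (path_hull \<omega>)"
  by (rule inradius_ge[OF bounded_path_hull, of _ 0 "W 0 \<omega>"]) (auto intro!: hull_inc)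

text \<open>A bound on the displacement of the first coordinate confines the path, hence its hull,
  to a vertical strip, and the half-width of the strip bounds the inradius.\<close>

lemma integrable_inradius_path_hull: "integrable M (\<lambda>\<omega>. inradius (path_hull \<omega>))"
proof -
  obtain S where S: "S \<in> borel_measurable M" "(\<integral>\<^sup>+\<omega>. S \<omega> \<partial>M) < \<infinity>"
    "\<And>\<omega> t. \<omega> \<in> space M \<Longrightarrow> t \<in> {0..1} \<Longrightarrow> ennreal \<bar>W t \<omega> $ 1 - W 0 \<omega> $ 1\<bar> \<le> S \<omega>"
    using standard_brownian_motion.integrable_range_bound[OF coordinate_brownian] by blast
  have le: "ennreal (inradius (path_hull \<omega>)) \<le> S \<omega>" if \<omega>: "\<omega> \<in> space M" for \<omega>
  \<comment> \<open>Where the random bound is infinite there is nothing to show.\<close>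
  proof (cases "S \<omega>")
    case (real s)
    let ?m = "W 0 \<omega> $ 1"
    have "path_hull \<omega> \<subseteq> {x. axis 1 1 \<bullet> x \<le> ?m + s} \<inter> {x. axis 1 1 \<bullet> x \<ge> ?m - s}"
    proof (intro hull_minimal convex_Int convex_halfspace_le convex_halfspace_ge)
      show "(\<lambda>t. W t \<omega>) ` {0..1} \<subseteq> {x. axis 1 1 \<bullet> x \<le> ?m + s} \<inter> {x. axis 1 1 \<bullet> x \<ge> ?m - s}"
      proof (rule image_subsetI)
        fix t :: real assume "t \<in> {0..1}"
        then have "\<bar>W t \<omega> $ 1 - ?m\<bar> \<le> s" using S(3)[OF \<omega>] real by fastforce
        then show "W t \<omega> \<in> {x. axis 1 1 \<bullet> x \<le> ?m + s} \<inter> {x. axis 1 1 \<bullet> x \<ge> ?m - s}"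
          by (auto simp: inner_axis' abs_le_iff)
      qed
    qed
    then have "\<bar>x $ 1 - ?m\<bar> \<le> s" if "x \<in> path_hull \<omega>" for x
      using that by (auto simp: inner_axis' abs_le_iff)
    then have "inradius (path_hull \<omega>) \<le> s"
      by (rule inradius_le_strip[rotated]) auto
    then show ?thesis unfolding real by (rule ennreal_leI)
  qed simp
  show ?thesis
  proof (rule integrableI_bounded)
    show "(\<lambda>\<omega>. inradius (path_hull \<omega>)) \<in> borel_measurable M"
      by (rule borel_measurable_inradius_path[OF borel_measurable_at continuous_on_path])
    have "(\<integral>\<^sup>+\<omega>. ennreal (norm (inradius (path_hull \<omega>))) \<partial>M) \<le> (\<integral>\<^sup>+\<omega>. S \<omega> \<partial>M)"
      by (rule nn_integral_mono) (simp add: inradius_path_hull_nonneg le)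
    with S(2) show "(\<integral>\<^sup>+\<omega>. ennreal (norm (inradius (path_hull \<omega>))) \<partial>M) < \<infinity>" by simp
  qed
qed

lemma incircle_radius_le_inradius:
  assumes "\<omega> \<in> space M"
  shows "incircle_radius ((W (1 / 2) \<omega> - W 0 \<omega>) $ 1) ((W 1 \<omega> - W (1 / 2) \<omega>) $ 1)
    ((W (1 / 2) \<omega> - W 0 \<omega>) $ 2) ((W 1 \<omega> - W (1 / 2) \<omega>) $ 2) \<le> inradius (path_hull \<omega>)"
proof -
  let ?A = "W 0 \<omega>" and ?B = "W (1 / 2) \<omega>" and ?C = "W 1 \<omega>"
  obtain c where "cball c (\<bar>(?B - ?A) $ 1 * (?C - ?B) $ 2 - (?B - ?A) $ 2 * (?C - ?B) $ 1\<bar> /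
      (norm (?B - ?A) + norm (?C - ?B) + norm (?C - ?A))) \<subseteq> convex hull {?A, ?B, ?C}"
    using triangle_contains_disk by blast
  also have "\<bar>(?B - ?A) $ 1 * (?C - ?B) $ 2 - (?B - ?A) $ 2 * (?C - ?B) $ 1\<bar> /
      (norm (?B - ?A) + norm (?C - ?B) + norm (?C - ?A)) =
    incircle_radius ((?B - ?A) $ 1) ((?C - ?B) $ 1) ((?B - ?A) $ 2) ((?C - ?B) $ 2)"
    by (simp add: incircle_radius_def norm_vec_def L2_set_def sum_2 mult.commute)
  also have "convex hull {?A, ?B, ?C} \<subseteq> path_hull \<omega>"
    by (rule hull_mono) auto
  finally show ?thesis
    using inradius_ge[OF bounded_path_hull[OF assms] incircle_radius_nonneg] by blast
qed

end

theorem proposition1p5: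
  fixes M :: "'a measure" and W :: "real \<Rightarrow> 'a \<Rightarrow> real ^ 2"
  assumes "planar_brownian_motion M W"
  shows "prob_space.expectation M (\<lambda>\<omega>. inradius (convex hull ((\<lambda>s. W s \<omega>) ` {0..1})))
    \<ge> sqrt pi / (8 + 4 * sqrt 2)"
proof -
  interpret planar_brownian_motion M W by fact
  let ?r = "\<lambda>\<omega>. inradius (path_hull \<omega>)"
  let ?X = "\<lambda>i \<omega>. (W (1 / 2) \<omega> - W 0 \<omega>) $ i" and ?Y = "\<lambda>i \<omega>. (W 1 \<omega> - W (1 / 2) \<omega>) $ i"
  have "ennreal (sqrt pi / (8 + 4 * sqrt 2)) \<le>
      (\<integral>\<^sup>+\<omega>. ennreal (incircle_radius (?X 1 \<omega>) (?Y 1 \<omega>) (?X 2 \<omega>) (?Y 2 \<omega>)) \<partial>M)"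
    by (subst nn_integral_half_increments)
      (unfold case_prod_beta, measurable, rule nn_integral_gaussian_incircle_radius_ge)
  also have "\<dots> \<le> (\<integral>\<^sup>+\<omega>. ennreal (?r \<omega>) \<partial>M)"
    by (intro nn_integral_mono ennreal_leI incircle_radius_le_inradius)
  \<comment> \<open>Integrability turns the bound on the nonnegative integral into one on the
    expectation.\<close>
  also have "\<dots> = ennreal (expectation ?r)"
    by (intro nn_integral_eq_integral integrable_inradius_path_hull AE_I2 inradius_path_hull_nonneg)
  finally show ?thesis
    by (simp add: ennreal_le_iff Bochner_Integration.integral_nonneg inradius_path_hull_nonneg)
qed

end
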